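(* A simplicial set $X$ is fibrant in the minimal model structure on simplicial sets if and only if it has lifts with respect to all iso-horn inclusions, i.e. if and only if the map $X\to\ast$ to the terminal simplicial set has the right lifting property with respect to every iso-horn inclusion $\overline{\mathbb{V}}_i[n]\hookrightarrow \overline{\nabla}_i[n]$ with $n\geq 1$ and $0\leq i\leq n-1$. (Here $\overline{\mathbb{V}}_i[n]$ is the iso-horn and $\overline{\nabla}_i[n]$ the isoplex.)
   Context: Simplicial sets are functors $\Delta^{\mathrm{op}}\to\mathsf{Set}$; $\Delta[n]$ is the standard $n$-simplex and $\partial\Delta[n]$ its boundary. $J=N(\mathbb{I})$ is the nerve of the free-living isomorphism $\mathbb{I}$ (two objects $0,1$ and exactly one morphism in each hom-set). A Cisinski model structure on the category $\mathsf{sSet}$ of simplicial sets is a cofibrantly generated model structure whose cofibrations are exactly the monomorphisms. One Cisinski model structure is a localization of another if its class of weak equivalences contains that of the other. The minimal (Cisinski) model structure is the Cisinski model structure on $\mathsf{sSet}$ of which every Cisinski model structure on $\mathsf{sSet}$ is a localization; it exists, and it is the Cisinski model structure in which a simplicial set $X$ is fibrant if and only if $X\to\ast$ has the right lifting property with respect to the pushout-products $$(J\times\partial\Delta[n])\cup(\{0\}\times\Delta[n])\hookrightarrow J\times\Delta[n],\qquad n\geq 0.$$ Given a set of vertices $S$ of a simplicial set $Z$, the full subcomplex of $Z$ on $S$ consists of the simplices of $Z$ all of whose vertices lie in $S$. For a simplicial set $X$ and $\nu\subseteq X_0$, the widening $W_\nu(X)$ of $X$ at $\nu$ is the full subcomplex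 of $J\times X$ on the vertex set $(\{0\}\times X_0)\cup(\{1\}\times\nu)$. For $n\geq 1$ and $0\leq i\leq n-1$, the isoplex is $\overline{\nabla}_i[n]=W_{\{i\}}(\Delta[n-1])$, and the iso-horn is its subcomplex $\overline{\mathbb{V}}_i[n]=W_{\{i\}\cap(\partial\Delta[n-1])_0}(\partial\Delta[n-1])\cup(\{0\}\times\Delta[n-1])$. The inclusion $\overline{\mathbb{V}}_i[n]\hookrightarrow\overline{\nabla}_i[n]$ is called an iso-horn inclusion. *)

theory Defs
  imports "HOL-Library.FuncSet" "HOL-Library.Equipollence"
begin

section \<open>Simplicial sets\<close>

text \<open>The set of morphisms \<open>[m] \<rightarrow> [n]\<close> of the simplex category, as extensional functions, so that
  equality of morphisms is equality in HOL.\<close>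

definition delta_hom :: "nat \<Rightarrow> nat \<Rightarrow> (nat \<Rightarrow> nat) set" where
  "delta_hom m n = {\<theta> \<in> {..m} \<rightarrow>\<^sub>E {..n}. mono_on {..m} \<theta>}"

text \<open>\<open>act X m n \<theta>\<close> is the map from \<open>simps X n\<close> to \<open>simps X m\<close> induced by \<open>\<theta> : [m] \<rightarrow> [n]\<close>.\<close>

record 'a sset =
  simps :: "nat \<Rightarrow> 'a set"
  act :: "nat \<Rightarrow> nat \<Rightarrow> (nat \<Rightarrow> nat) \<Rightarrow> 'a \<Rightarrow> 'a"

definition simplicial_set :: "'a sset \<Rightarrow> bool" where
  "simplicial_set X \<longleftrightarrow>
     (\<forall>m n. \<forall>\<theta>\<in>delta_hom m n. act X m n \<theta> \<in> simps X n \<rightarrow> simps X m) \<and>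
     (\<forall>n. \<forall>x\<in>simps X n. act X n n (\<lambda>k\<in>{..n}. k) x = x) \<and>
     (\<forall>l m n. \<forall>\<phi>\<in>delta_hom l m. \<forall>\<theta>\<in>delta_hom m n. \<forall>x\<in>simps X n.
        act X l n (compose {..l} \<theta> \<phi>) x = act X l m \<phi> (act X m n \<theta> x))"

type_synonym ('a, 'b) smap = "nat \<Rightarrow> 'a \<Rightarrow> 'b"

definition shom :: "'a sset \<Rightarrow> 'b sset \<Rightarrow> ('a, 'b) smap set" where
  "shom X Y = {f. (\<forall>n. f n \<in> simps X n \<rightarrow>\<^sub>E simps Y n) \<and>
     (\<forall>m n. \<forall>\<theta>\<in>delta_hom m n. \<forall>x\<in>simps X n. f m (act X m n \<theta> x) = act Y m n \<theta> (f n x))}"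

text \<open>\<open>scomp X g f\<close> is the composite \<open>g \<circ> f\<close> of maps whose source is \<open>X\<close>.\<close>

definition scomp :: "'a sset \<Rightarrow> ('b, 'c) smap \<Rightarrow> ('a, 'b) smap \<Rightarrow> ('a, 'c) smap" where
  "scomp X g f = (\<lambda>n. compose (simps X n) (g n) (f n))"

text \<open>The identity of \<open>X\<close>; it is also the inclusion of \<open>X\<close> into any simplicial set containing \<open>X\<close>.\<close>

definition sincl :: "'a sset \<Rightarrow> ('a, 'a) smap" where
  "sincl X = (\<lambda>n. \<lambda>x\<in>simps X n. x)"

definition subcomplex :: "'a sset \<Rightarrow> 'a sset \<Rightarrow> bool" where
  "subcomplex A X \<longleftrightarrow> simplicial_set A \<and> simplicial_set X \<and>
     (\<forall>n. simps A n \<subseteq> simps X n) \<and> sincl A \<in> shom A X"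

text \<open>The terminal simplicial set: a single simplex in each dimension. The element
  \<open>undefined\<close> only serves as a fixed element of the ambient type.\<close>

definition terminal_sset :: "'a sset" where
  "terminal_sset = \<lparr>simps = (\<lambda>n. {undefined}), act = (\<lambda>m n \<theta> x. x)\<rparr>"

definition to_terminal :: "'a sset \<Rightarrow> ('a, 'b) smap" where
  "to_terminal X = (\<lambda>n. \<lambda>x\<in>simps X n. undefined)"

text \<open>\<open>lifting A B i X Y p\<close>: the map \<open>i : A \<rightarrow> B\<close> has the left lifting property against
  \<open>p : X \<rightarrow> Y\<close>.\<close>

definition lifting ::
  "'a sset \<Rightarrow> 'b sset \<Rightarrow> ('a, 'b) smap \<Rightarrow> 'c sset \<Rightarrow> 'd sset \<Rightarrow> ('c, 'd) smap \<Rightarrow> bool" where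
  "lifting A B i X Y p \<longleftrightarrow>
     (\<forall>u\<in>shom A X. \<forall>v\<in>shom B Y. scomp A p u = scomp A v i \<longrightarrow>
        (\<exists>h\<in>shom B X. scomp A h i = u \<and> scomp B p h = v))"

text \<open>\<open>X \<rightarrow> *\<close> has the right lifting property against the inclusion \<open>A \<hookrightarrow> B\<close>.\<close>

definition has_lifts :: "'a sset \<Rightarrow> 'b sset \<Rightarrow> 'b sset \<Rightarrow> bool" where
  "has_lifts X A B \<longleftrightarrow>
     lifting A B (sincl A) X (terminal_sset :: 'a sset) (to_terminal X)"


section \<open>Constructions\<close>

definition sprod :: "'a sset \<Rightarrow> 'b sset \<Rightarrow> ('a \<times> 'b) sset" where
  "sprod X Y = \<lparr>simps = (\<lambda>n. simps X n \<times> simps Y n),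
     act = (\<lambda>m n \<theta>. map_prod (act X m n \<theta>) (act Y m n \<theta>))\<rparr>"

text \<open>Union of two subcomplexes of a common simplicial set (they then carry the same action).\<close>

definition sunion :: "'a sset \<Rightarrow> 'a sset \<Rightarrow> 'a sset" where
  "sunion A B = A\<lparr>simps := (\<lambda>n. simps A n \<union> simps B n)\<rparr>"

definition Delta :: "nat \<Rightarrow> (nat \<Rightarrow> nat) sset" where
  "Delta n = \<lparr>simps = (\<lambda>m. delta_hom m n), act = (\<lambda>l m \<theta> x. compose {..l} x \<theta>)\<rparr>"

definition boundary_Delta :: "nat \<Rightarrow> (nat \<Rightarrow> nat) sset" where
  "boundary_Delta n = (Delta n)\<lparr>simps := (\<lambda>m. {x \<in> delta_hom m n. x ` {..m} \<noteq> {..n}})\<rparr>"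

definition Delta_vertex :: "nat \<Rightarrow> nat \<Rightarrow> nat" where
  "Delta_vertex i = (\<lambda>k\<in>{..0}. i)"

definition vertex :: "'a sset \<Rightarrow> nat \<Rightarrow> nat \<Rightarrow> 'a \<Rightarrow> 'a" where
  "vertex Z n i x = act Z 0 n (\<lambda>k\<in>{..0}. i) x"

definition full_subcomplex :: "'a sset \<Rightarrow> 'a set \<Rightarrow> 'a sset" where
  "full_subcomplex Z S = Z\<lparr>simps := (\<lambda>n. {x \<in> simps Z n. \<forall>i\<le>n. vertex Z n i x \<in> S})\<rparr>"

text \<open>The subcomplex isomorphic to \<open>\<Delta>[0]\<close> generated by a vertex \<open>v\<close>, i.e. \<open>v\<close> and its degeneracies.\<close>

definition point_subcomplex :: "'a sset \<Rightarrow> 'a \<Rightarrow> 'a sset" where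
  "point_subcomplex Z v = Z\<lparr>simps := (\<lambda>n. {act Z n 0 (\<lambda>k\<in>{..n}. 0) v})\<rparr>"


section \<open>The nerve of the free-living isomorphism\<close>

text \<open>\<open>Cmp C a b c g f\<close> is the composite of \<open>f : a \<rightarrow> b\<close> and \<open>g : b \<rightarrow> c\<close>.\<close>

record ('o, 'm) cat =
  Obj :: "'o set"
  Hom :: "'o \<Rightarrow> 'o \<Rightarrow> 'm set"
  Idt :: "'o \<Rightarrow> 'm"
  Cmp :: "'o \<Rightarrow> 'o \<Rightarrow> 'o \<Rightarrow> 'm \<Rightarrow> 'm \<Rightarrow> 'm"

text \<open>An \<open>m\<close>-simplex of the nerve is a functor \<open>(F, G)\<close> from the poset \<open>[m]\<close>, where \<open>F\<close> is its
  object part and \<open>G i j\<close> is the image of the arrow \<open>i \<le> j\<close>.\<close>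

definition nerve :: "('o, 'm) cat \<Rightarrow> ((nat \<Rightarrow> 'o) \<times> (nat \<Rightarrow> nat \<Rightarrow> 'm)) sset" where
  "nerve C = \<lparr>
     simps = (\<lambda>m. {(F, G). F \<in> {..m} \<rightarrow>\<^sub>E Obj C \<and>
        (\<forall>i j. if i \<le> j \<and> j \<le> m then G i j \<in> Hom C (F i) (F j) else G i j = undefined) \<and>
        (\<forall>i\<le>m. G i i = Idt C (F i)) \<and>
        (\<forall>i j k. i \<le> j \<and> j \<le> k \<and> k \<le> m \<longrightarrow>
           G i k = Cmp C (F i) (F j) (F k) (G j k) (G i j))}),
     act = (\<lambda>l m \<theta> (F, G). (compose {..l} F \<theta>,
        \<lambda>i j. if i \<le> j \<and> j \<le> l then G (\<theta> i) (\<theta> j) else undefined))\<rparr>"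

definition free_iso :: "(nat, unit) cat" where
  "free_iso = \<lparr>Obj = {0, 1}, Hom = (\<lambda>a b. {()}), Idt = (\<lambda>a. ()), Cmp = (\<lambda>a b c g f. ())\<rparr>"

type_synonym J_simplex = "(nat \<Rightarrow> nat) \<times> (nat \<Rightarrow> nat \<Rightarrow> unit)"

definition J :: "J_simplex sset" where
  "J = nerve free_iso"

definition J_vertex :: "nat \<Rightarrow> J_simplex" where
  "J_vertex a = (\<lambda>k\<in>{..0}. a, \<lambda>i j. ())"

text \<open>The source of the pushout-product inclusion into \<open>J \<times> \<Delta>[n]\<close>.\<close>

definition J_pushout_product :: "nat \<Rightarrow> (J_simplex \<times> (nat \<Rightarrow> nat)) sset" where
  "J_pushout_product n = sunion (sprod J (boundary_Delta n))
     (sprod (point_subcomplex J (J_vertex 0)) (Delta n))"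


section \<open>Widenings, isoplexes and iso-horns\<close>

definition widening :: "'a set \<Rightarrow> 'a sset \<Rightarrow> (J_simplex \<times> 'a) sset" where
  "widening \<nu> X = full_subcomplex (sprod J X)
     (({J_vertex 0} \<times> simps X 0) \<union> ({J_vertex 1} \<times> \<nu>))"

definition isoplex :: "nat \<Rightarrow> nat \<Rightarrow> (J_simplex \<times> (nat \<Rightarrow> nat)) sset" where
  "isoplex i n = widening {Delta_vertex i} (Delta (n - 1))"

definition iso_horn :: "nat \<Rightarrow> nat \<Rightarrow> (J_simplex \<times> (nat \<Rightarrow> nat)) sset" where
  "iso_horn i n = sunion
     (widening ({Delta_vertex i} \<inter> simps (boundary_Delta (n - 1)) 0) (boundary_Delta (n - 1)))
     (sprod (point_subcomplex J (J_vertex 0)) (Delta (n - 1)))"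

section \<open>Well-formedness\<close>

lemma delta_hom_comp:
  assumes "\<phi> \<in> delta_hom l m" "\<theta> \<in> delta_hom m n"
  shows "compose {..l} \<theta> \<phi> \<in> delta_hom l n"
proof -
  have "\<phi> k \<le> m" if "k \<le> l" for k using assms(1) that by (auto simp: delta_hom_def)
  moreover have "\<theta> k \<le> n" if "k \<le> m" for k using assms(2) that by (auto simp: delta_hom_def)
  ultimately show ?thesis
    using assms by (auto simp: delta_hom_def compose_def mono_on_def)
qed

lemma delta_hom_const: "i \<le> n \<Longrightarrow> (\<lambda>k\<in>{..m}. i) \<in> delta_hom m n"
  by (auto simp: delta_hom_def mono_on_def)

lemma simplicial_set_restrict:
  assumes "simplicial_set X" "\<And>n. S n \<subseteq> simps X n"
    "\<And>m n \<theta> x. \<theta> \<in> delta_hom m n \<Longrightarrow> x \<in> S n \<Longrightarrow> act X m n \<theta> x \<in> S m"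
  shows "simplicial_set (X\<lparr>simps := S\<rparr>)"
  using assms unfolding simplicial_set_def by (simp add: Pi_iff subset_iff)

lemma subcomplexI:
  assumes "simplicial_set A" "simplicial_set X" "\<And>n. simps A n \<subseteq> simps X n" "act A = act X"
  shows "subcomplex A X"
  using assms unfolding subcomplex_def shom_def sincl_def simplicial_set_def
  by (auto simp: Pi_iff)

lemma simplicial_set_sprod:
  "simplicial_set X \<Longrightarrow> simplicial_set Y \<Longrightarrow> simplicial_set (sprod X Y)"
  unfolding simplicial_set_def sprod_def by (auto simp: Pi_iff)

lemma simplicial_set_sunion:
  assumes "simplicial_set A" "simplicial_set B" "act A = act B"
  shows "simplicial_set (sunion A B)"
  using assms unfolding simplicial_set_def sunion_def by (auto simp: Pi_iff)

lemma simplicial_set_full_subcomplex: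
  assumes X: "simplicial_set X"
  shows "simplicial_set (full_subcomplex X S)"
  unfolding full_subcomplex_def
proof (rule simplicial_set_restrict[OF X])
  fix m n \<theta> x
  assume t: "\<theta> \<in> delta_hom m n"
    and x: "x \<in> {x \<in> simps X n. \<forall>i\<le>n. vertex X n i x \<in> S}"
  have 1: "act X m n \<theta> x \<in> simps X m" using X t x by (auto simp: simplicial_set_def Pi_iff)
  have "vertex X m i (act X m n \<theta> x) = vertex X n (\<theta> i) x" if i: "i \<le> m" for i
  proof -
    have "compose {..0} \<theta> (\<lambda>k\<in>{..0}. i) = (\<lambda>k\<in>{..0}. \<theta> i)"
      by (auto simp: compose_def)
    moreover have "act X 0 n (compose {..0} \<theta> (\<lambda>k\<in>{..0}. i)) x =
        act X 0 m (\<lambda>k\<in>{..0}. i) (act X m n \<theta> x)"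
      using X t x delta_hom_const[OF i, of 0] unfolding simplicial_set_def by blast
    ultimately show ?thesis unfolding vertex_def by metis
  qed
  moreover have "\<theta> i \<le> n" if "i \<le> m" for i using t that by (auto simp: delta_hom_def)
  ultimately show "act X m n \<theta> x \<in> {x \<in> simps X m. \<forall>i\<le>m. vertex X m i x \<in> S}"
    using 1 x by auto
qed auto

lemma simplicial_set_Delta: "simplicial_set (Delta n)"
proof -
  have "compose {..m} x (\<lambda>k\<in>{..m}. k) = x" if "x \<in> delta_hom m n" for x m
    using that by (auto simp: delta_hom_def compose_def fun_eq_iff PiE_def extensional_def)
  moreover have "compose {..l} x (compose {..l} \<theta> \<phi>) = compose {..l} (compose {..m} x \<theta>) \<phi>"
    if "\<phi> \<in> delta_hom l m" for x \<theta> \<phi> l m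
    using that by (auto simp: delta_hom_def compose_def fun_eq_iff)
  ultimately show ?thesis
    by (auto simp: simplicial_set_def Delta_def intro: delta_hom_comp)
qed

lemma simplicial_set_boundary_Delta: "simplicial_set (boundary_Delta n)"
proof -
  have "x ` {..m} = {..n}" if "\<theta> \<in> delta_hom l m" "x \<in> delta_hom m n"
    "compose {..l} x \<theta> ` {..l} = {..n}" for x \<theta> l m
  proof -
    have "compose {..l} x \<theta> ` {..l} \<subseteq> x ` {..m}"
      using that(1) by (auto simp: compose_def delta_hom_def)
    moreover have "x ` {..m} \<subseteq> {..n}" using that(2) by (auto simp: delta_hom_def)
    ultimately show ?thesis using that(3) by auto
  qed
  moreover have "{x \<in> delta_hom m n. x ` {..m} \<noteq> {..n}} \<subseteq> simps (Delta n) m" for m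
    by (auto simp: Delta_def)
  ultimately show ?thesis unfolding boundary_Delta_def
    by (intro simplicial_set_restrict[OF simplicial_set_Delta])
       (simp_all add: Delta_def delta_hom_comp, blast)
qed

lemma simps_J: "simps J m = ({..m} \<rightarrow>\<^sub>E {0, 1}) \<times> UNIV"
  by (auto simp: J_def nerve_def free_iso_def)

lemma simplicial_set_J: "simplicial_set J"
proof -
  have 1: "compose {..l} F \<theta> \<in> {..l} \<rightarrow>\<^sub>E {0, 1}"
    if "\<theta> \<in> delta_hom l m" "F \<in> {..m} \<rightarrow>\<^sub>E {0, 1}" for F :: "nat \<Rightarrow> nat" and \<theta> l m
  proof -
    have "F (\<theta> k) \<in> {0, 1}" if "k \<le> l" for k
    proof -
      have "\<theta> k \<in> {..m}" using that \<open>\<theta> \<in> delta_hom l m\<close> by (auto simp: delta_hom_def)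
      thus ?thesis using \<open>F \<in> _\<close> by blast
    qed
    thus ?thesis by (simp add: compose_def)
  qed
  have 2: "compose {..m} F (\<lambda>k\<in>{..m}. k) = F"
    if "F \<in> {..m} \<rightarrow>\<^sub>E {0, 1}" for F :: "nat \<Rightarrow> nat" and m
    using that by (auto simp: compose_def fun_eq_iff PiE_def extensional_def)
  have 3: "compose {..l} F (compose {..l} \<theta> \<phi>) = compose {..l} (compose {..m} F \<theta>) \<phi>"
    if "\<phi> \<in> delta_hom l m" for F :: "nat \<Rightarrow> nat" and \<theta> \<phi> l m
    using that by (auto simp: delta_hom_def compose_def fun_eq_iff)
  have eq: "p = q" if "fst p = fst q" for p q :: J_simplex
    using that by (simp add: prod_eq_iff fun_eq_iff)
  have fst_act: "fst (act J l m \<theta> p) = compose {..l} (fst p) \<theta>" for l m \<theta> p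
    by (cases p) (simp add: J_def nerve_def)
  have mem: "p \<in> simps J m \<longleftrightarrow> fst p \<in> {..m} \<rightarrow>\<^sub>E {0, 1}" for p m
    by (cases p) (simp add: simps_J)
  show ?thesis unfolding simplicial_set_def
  proof (intro conjI allI ballI)
    fix m n \<theta> assume "\<theta> \<in> delta_hom m n"
    thus "act J m n \<theta> \<in> simps J n \<rightarrow> simps J m" by (intro funcsetI) (simp only: mem fst_act 1)
  next
    fix n x assume "x \<in> simps J n"
    thus "act J n n (\<lambda>k\<in>{..n}. k) x = x" by (intro eq) (simp only: mem fst_act 2)
  next
    fix l m n \<phi> \<theta> x assume "\<phi> \<in> delta_hom l m"
    thus "act J l n (compose {..l} \<theta> \<phi>) x = act J l m \<phi> (act J m n \<theta> x)"
      by (intro eq) (simp only: fst_act 3)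
  qed
qed

lemma J_vertex_in: "a \<in> {0, 1} \<Longrightarrow> J_vertex a \<in> simps J 0"
  by (auto simp: simps_J J_vertex_def)

lemma simplicial_set_point_subcomplex:
  assumes X: "simplicial_set X" and v: "v \<in> simps X 0"
  shows "simplicial_set (point_subcomplex X v)"
  unfolding point_subcomplex_def
proof (rule simplicial_set_restrict[OF X])
  fix n show "{act X n 0 (\<lambda>k\<in>{..n}. 0) v} \<subseteq> simps X n"
    using X v delta_hom_const[of 0 0 n] by (auto simp: simplicial_set_def Pi_iff)
next
  fix m n \<theta> x assume t: "\<theta> \<in> delta_hom m n" and x: "x \<in> {act X n 0 (\<lambda>k\<in>{..n}. 0) v}"
  have "compose {..m} (\<lambda>k\<in>{..n}. 0) \<theta> = (\<lambda>k\<in>{..m}. 0::nat)"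
    using t by (auto simp: compose_def delta_hom_def fun_eq_iff)
  thus "act X m n \<theta> x \<in> {act X m 0 (\<lambda>k\<in>{..m}. 0) v}"
    using X v t x delta_hom_const[of 0 0 n] unfolding simplicial_set_def by (metis le0 singletonD singletonI)
qed

lemmas simplicial_set_intros =
  simplicial_set_sprod simplicial_set_sunion simplicial_set_full_subcomplex simplicial_set_Delta
  simplicial_set_boundary_Delta simplicial_set_J simplicial_set_point_subcomplex J_vertex_in

lemma act_boundary_Delta: "act (boundary_Delta n) = act (Delta n)"
  by (simp add: boundary_Delta_def)

lemma simps_boundary_Delta_subset: "simps (boundary_Delta n) m \<subseteq> simps (Delta n) m"
  by (auto simp: boundary_Delta_def Delta_def)

lemma simps_point_J_subset: "simps (point_subcomplex J (J_vertex 0)) m \<subseteq> simps J m"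
  using simplicial_set_J J_vertex_in[of 0] delta_hom_const[of 0 0 m]
  by (auto simp: point_subcomplex_def simplicial_set_def Pi_iff)

lemma J_pushout_product_subcomplex: "subcomplex (J_pushout_product n) (sprod J (Delta n))"
proof (rule subcomplexI)
  show "simplicial_set (J_pushout_product n)" unfolding J_pushout_product_def
    by (intro simplicial_set_intros)
       (auto simp: sprod_def point_subcomplex_def act_boundary_Delta)
  show "simplicial_set (sprod J (Delta n))" by (intro simplicial_set_intros)
  show "simps (J_pushout_product n) m \<subseteq> simps (sprod J (Delta n)) m" for m
    using simps_boundary_Delta_subset[of n m] simps_point_J_subset[of m]
    by (auto simp: J_pushout_product_def sunion_def sprod_def)
  show "act (J_pushout_product n) = act (sprod J (Delta n))"
    by (simp add: J_pushout_product_def sunion_def sprod_def act_boundary_Delta)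
qed

lemma iso_horn_subcomplex: "subcomplex (iso_horn i n) (isoplex i n)"
proof (rule subcomplexI)
  define N where "N = n - 1"
  let ?D = "Delta N" and ?B = "boundary_Delta N" and ?P = "point_subcomplex J (J_vertex 0)"
  have acts: "act (sprod J ?B) = act (sprod J ?D)" "act (sprod ?P ?D) = act (sprod J ?D)"
    by (simp_all add: sprod_def point_subcomplex_def act_boundary_Delta)
  show "simplicial_set (iso_horn i n)" unfolding iso_horn_def N_def[symmetric] widening_def
    by (intro simplicial_set_intros) (simp_all add: full_subcomplex_def acts)
  show "simplicial_set (isoplex i n)" unfolding isoplex_def N_def[symmetric] widening_def
    by (intro simplicial_set_intros)
  show "act (iso_horn i n) = act (isoplex i n)"
    unfolding iso_horn_def isoplex_def N_def[symmetric]
    by (simp add: widening_def sunion_def full_subcomplex_def acts)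
  fix m
  have v: "vertex (sprod J ?B) m k x = vertex (sprod J ?D) m k x" for k x
    by (simp add: vertex_def acts)
  have "simps (sprod ?P ?D) m \<subseteq> simps (isoplex i n) m"
  proof
    fix x assume x: "x \<in> simps (sprod ?P ?D) m"
    then obtain d where d: "x = (act J m 0 (\<lambda>k\<in>{..m}. 0) (J_vertex 0), d)" "d \<in> simps ?D m"
      by (auto simp: sprod_def point_subcomplex_def)
    have "vertex (sprod J ?D) m k x \<in> {J_vertex 0} \<times> simps ?D 0" if k: "k \<le> m" for k
    proof -
      have "act J 0 m (\<lambda>l\<in>{..0}. k) (act J m 0 (\<lambda>k\<in>{..m}. 0) (J_vertex 0)) = J_vertex 0"
        using k by (auto simp: J_def nerve_def J_vertex_def compose_def fun_eq_iff)
      moreover have "act ?D 0 m (\<lambda>l\<in>{..0}. k) d \<in> simps ?D 0"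
        using simplicial_set_Delta d(2) delta_hom_const[OF k]
        unfolding simplicial_set_def by blast
      ultimately show ?thesis using d by (simp add: vertex_def sprod_def)
    qed
    moreover have "x \<in> simps (sprod J ?D) m"
      using x simps_point_J_subset[of m] by (auto simp: sprod_def)
    ultimately show "x \<in> simps (isoplex i n) m"
      unfolding isoplex_def N_def[symmetric] by (auto simp: widening_def full_subcomplex_def)
  qed
  moreover have "simps (widening ({Delta_vertex i} \<inter> simps ?B 0) ?B) m \<subseteq> simps (isoplex i n) m"
  proof
    fix x assume x: "x \<in> simps (widening ({Delta_vertex i} \<inter> simps ?B 0) ?B) m"
    have "x \<in> simps (sprod J ?D) m"
      using x simps_boundary_Delta_subset[of N m]
      by (auto simp: widening_def full_subcomplex_def sprod_def)
    moreover have "vertex (sprod J ?D) m k x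
        \<in> ({J_vertex 0} \<times> simps ?D 0) \<union> ({J_vertex 1} \<times> {Delta_vertex i})" if "k \<le> m" for k
    proof -
      have "vertex (sprod J ?D) m k x
          \<in> ({J_vertex 0} \<times> simps ?B 0) \<union> ({J_vertex 1} \<times> ({Delta_vertex i} \<inter> simps ?B 0))"
        using x that by (simp add: widening_def full_subcomplex_def v)
      moreover have "({J_vertex 0} \<times> simps ?B 0) \<union> ({J_vertex 1} \<times> ({Delta_vertex i} \<inter> simps ?B 0))
          \<subseteq> ({J_vertex 0} \<times> simps ?D 0) \<union> ({J_vertex 1} \<times> {Delta_vertex i})"
        by (intro Un_mono Sigma_mono simps_boundary_Delta_subset order_refl Int_lower1)
      ultimately show ?thesis by (rule subsetD[rotated])
    qed
    ultimately show "x \<in> simps (isoplex i n) m"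
      unfolding isoplex_def N_def[symmetric] by (simp add: widening_def full_subcomplex_def)
  qed
  ultimately show "simps (iso_horn i n) m \<subseteq> simps (isoplex i n) m"
    unfolding iso_horn_def N_def[symmetric] by (simp add: sunion_def)
qed


section \<open>Cisinski model structures on simplicial sets\<close>

text \<open>The category \<open>sSet\<close> is rendered as that of the simplicial sets with simplices in a type
  \<open>'a\<close>, which plays the role of the universe of small sets.\<close>

type_synonym 'a map_class = "'a sset \<Rightarrow> 'a sset \<Rightarrow> ('a, 'a) smap \<Rightarrow> bool"

record 'a model_data =
  weq :: "'a map_class"
  cof :: "'a map_class"
  fib :: "'a map_class"

definition arrow :: "'a map_class" where
  "arrow X Y f \<longleftrightarrow> simplicial_set X \<and> simplicial_set Y \<and> f \<in> shom X Y"

definition mono_map :: "'a map_class" where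
  "mono_map X Y f \<longleftrightarrow> arrow X Y f \<and> (\<forall>n. inj_on (f n) (simps X n))"

definition retract_of :: "'a sset \<Rightarrow> 'a sset \<Rightarrow> ('a, 'a) smap \<Rightarrow>
    'a sset \<Rightarrow> 'a sset \<Rightarrow> ('a, 'a) smap \<Rightarrow> bool" where
  "retract_of X Y f X' Y' g \<longleftrightarrow>
     (\<exists>s\<in>shom X X'. \<exists>r\<in>shom X' X. \<exists>s'\<in>shom Y Y'. \<exists>r'\<in>shom Y' Y.
        scomp X r s = sincl X \<and> scomp Y r' s' = sincl Y \<and>
        scomp X g s = scomp X s' f \<and> scomp X' f r = scomp X' r' g)"

definition retract_closed :: "'a map_class \<Rightarrow> bool" where
  "retract_closed P \<longleftrightarrow>
     (\<forall>X Y f X' Y' g. arrow X Y f \<and> P X' Y' g \<and> retract_of X Y f X' Y' g \<longrightarrow> P X Y f)"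

definition two_of_three :: "'a map_class \<Rightarrow> bool" where
  "two_of_three P \<longleftrightarrow>
     (\<forall>X Y Z f g. arrow X Y f \<and> arrow Y Z g \<longrightarrow>
        (P X Y f \<and> P Y Z g \<longrightarrow> P X Z (scomp X g f)) \<and>
        (P X Y f \<and> P X Z (scomp X g f) \<longrightarrow> P Y Z g) \<and>
        (P Y Z g \<and> P X Z (scomp X g f) \<longrightarrow> P X Y f))"

definition factors :: "'a map_class \<Rightarrow> 'a map_class \<Rightarrow> bool" where
  "factors L R \<longleftrightarrow>
     (\<forall>X Y f. arrow X Y f \<longrightarrow> (\<exists>Z i p. L X Z i \<and> R Z Y p \<and> f = scomp X p i))"

definition acof :: "'a model_data \<Rightarrow> 'a map_class" where
  "acof M X Y f \<longleftrightarrow> cof M X Y f \<and> weq M X Y f"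

definition afib :: "'a model_data \<Rightarrow> 'a map_class" where
  "afib M X Y f \<longleftrightarrow> fib M X Y f \<and> weq M X Y f"

definition lifts_against :: "'a map_class \<Rightarrow> 'a map_class \<Rightarrow> bool" where
  "lifts_against L R \<longleftrightarrow>
     (\<forall>A B i X Y p. L A B i \<and> R X Y p \<longrightarrow> lifting A B i X Y p)"

definition model_structure :: "'a model_data \<Rightarrow> bool" where
  "model_structure M \<longleftrightarrow>
     (\<forall>X Y f. weq M X Y f \<or> cof M X Y f \<or> fib M X Y f \<longrightarrow> arrow X Y f) \<and>
     two_of_three (weq M) \<and>
     retract_closed (weq M) \<and> retract_closed (cof M) \<and> retract_closed (fib M) \<and>
     lifts_against (acof M) (fib M) \<and> lifts_against (cof M) (afib M) \<and>
     factors (acof M) (fib M) \<and> factors (cof M) (afib M)"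

text \<open>The generators form a small set, i.e. one that can be indexed by elements of \<open>'a\<close>. All
  simplicial sets are small objects, so there is no further condition on the generators.\<close>

definition generates_rlp ::
  "('a sset \<times> 'a sset \<times> ('a, 'a) smap) set \<Rightarrow> 'a map_class \<Rightarrow> bool" where
  "generates_rlp K R \<longleftrightarrow> K \<lesssim> (UNIV :: 'a set) \<and> (\<forall>(A, B, i)\<in>K. arrow A B i) \<and>
     (\<forall>X Y p. R X Y p \<longleftrightarrow> arrow X Y p \<and> (\<forall>(A, B, i)\<in>K. lifting A B i X Y p))"

definition cofibrantly_generated :: "'a model_data \<Rightarrow> bool" where
  "cofibrantly_generated M \<longleftrightarrow> (\<exists>K. generates_rlp K (afib M)) \<and> (\<exists>K. generates_rlp K (fib M))"

definition cisinski_model_structure :: "'a model_data \<Rightarrow> bool" where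
  "cisinski_model_structure M \<longleftrightarrow>
     model_structure M \<and> cofibrantly_generated M \<and> cof M = mono_map"

definition localization_of :: "'a model_data \<Rightarrow> 'a model_data \<Rightarrow> bool" where
  "localization_of M' M \<longleftrightarrow> (\<forall>X Y f. weq M X Y f \<longrightarrow> weq M' X Y f)"

definition fibrant :: "'a model_data \<Rightarrow> 'a sset \<Rightarrow> bool" where
  "fibrant M X \<longleftrightarrow> fib M X terminal_sset (to_terminal X)"

text \<open>The minimal model structure, described both by its universal property among Cisinski model
  structures and by its fibrant objects. For a large enough type \<open>'a\<close> the two descriptions single
  out the same model structure, by Cisinski's theory; that fact is part of this definition
  and is not proved here.\<close>

definition minimal_model_structure :: "'a model_data \<Rightarrow> bool" where
  "minimal_model_structure M \<longleftrightarrow> cisinski_model_structure M \<and>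
     (\<forall>M'. cisinski_model_structure M' \<longrightarrow> localization_of M' M) \<and>
     (\<forall>X. simplicial_set X \<longrightarrow>
        (fibrant M X \<longleftrightarrow> (\<forall>n. has_lifts X (J_pushout_product n) (sprod J (Delta n)))))"

end

theory Submission
  imports Defs
begin

text \<open>The vertexwise map \<open>J \<times> \<Delta>[N] \<rightarrow> J \<times> \<Delta>[N]\<close> sending \<open>(1, k)\<close> to \<open>(0, k)\<close> for \<open>k \<noteq> i\<close> exhibits the
  iso-horn inclusion as a retract of the pushout-product.

  Conversely, widen \<open>\<Delta>[N]\<close> at its vertices \<open>0, \<dots>, N\<close> successively, ending at \<open>J \<times> \<Delta>[N]\<close>. When
  \<open>j\<close> is widened, the vertex \<open>(1, j)\<close> is still absent, so \<open>(0, j)\<close> occurs at most once in a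
  nondegenerate simplex, and each nondegenerate \<open>M\<close>-simplex lying over the interior of \<open>\<Delta>[N]\<close>
  contributes exactly one isoplex, glued along its iso-horn. Lifts are constructed
  cell by cell, by well-founded recursion on \<open>j + M\<close>.\<close>

section \<open>Lifting against inclusions, and extension over relative cell complexes\<close>

text \<open>Maps into the terminal simplicial set are unique, so every square commutes and only the
  extension of \<open>u\<close> along the inclusion remains. The pointwise form keeps
  \<open>scomp\<close> and extensionality out of the later arguments.\<close>

lemma has_lifts_iff:
  fixes X :: "'a sset"
  assumes X: "simplicial_set X" and AB: "subcomplex A B"
  shows "has_lifts X A B \<longleftrightarrow>
    (\<forall>u\<in>shom A X. \<exists>h\<in>shom B X. \<forall>n. \<forall>x\<in>simps A n. h n x = u n x)"
proof -
  let ?T = "terminal_sset :: 'a sset"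
  have sub: "simps A n \<subseteq> simps B n" for n using AB by (simp add: subcomplex_def)
  have B: "act B m n \<theta> x \<in> simps B m" if "\<theta> \<in> delta_hom m n" "x \<in> simps B n" for m n \<theta> x
    using AB that unfolding subcomplex_def simplicial_set_def by blast
  have v: "v = (\<lambda>n. \<lambda>x\<in>simps B n. undefined)" if "v \<in> shom B ?T" for v
  proof (intro ext)
    fix n x
    have "v n \<in> simps B n \<rightarrow>\<^sub>E {undefined}" using that by (simp add: shom_def terminal_sset_def)
    then show "v n x = (\<lambda>x\<in>simps B n. undefined) x"
      by (cases "x \<in> simps B n") (auto simp: PiE_def extensional_def)
  qed
  have v': "(\<lambda>n. \<lambda>x\<in>simps B n. undefined) \<in> shom B ?T"
    using B unfolding shom_def terminal_sset_def by (auto simp: Pi_iff)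
  have c: "scomp A h (sincl A) = u \<longleftrightarrow> (\<forall>n. \<forall>x\<in>simps A n. h n x = u n x)"
    if "u \<in> shom A X" for u h
    using that unfolding shom_def scomp_def sincl_def
    by (auto simp: fun_eq_iff compose_def PiE_def extensional_def restrict_def)
  have p: "scomp B (to_terminal X) h = (\<lambda>n. \<lambda>x\<in>simps B n. undefined)" if "h \<in> shom B X" for h
    using that unfolding shom_def scomp_def to_terminal_def
    by (auto simp: fun_eq_iff compose_def Pi_iff PiE_def)
  have q: "scomp A (to_terminal X) u = scomp A (\<lambda>n. \<lambda>x\<in>simps B n. undefined) (sincl A)"
    if "u \<in> shom A X" for u
  proof (intro ext)
    fix n x
    have "x \<in> simps A n \<Longrightarrow> u n x \<in> simps X n" using that by (auto simp: shom_def)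
    then show "scomp A (to_terminal X) u n x =
        scomp A (\<lambda>n. \<lambda>x\<in>simps B n. undefined) (sincl A) n x"
      using sub[of n] by (auto simp: scomp_def to_terminal_def sincl_def compose_def)
  qed
  show ?thesis
  proof
    assume L: "has_lifts X A B"
    show "\<forall>u\<in>shom A X. \<exists>h\<in>shom B X. \<forall>n. \<forall>x\<in>simps A n. h n x = u n x"
    proof
      fix u assume u: "u \<in> shom A X"
      then obtain h where "h \<in> shom B X" "scomp A h (sincl A) = u"
        using L v' q[OF u] unfolding has_lifts_def lifting_def by blast
      then show "\<exists>h\<in>shom B X. \<forall>n. \<forall>x\<in>simps A n. h n x = u n x" using c[OF u] by blast
    qed
  next
    assume R: "\<forall>u\<in>shom A X. \<exists>h\<in>shom B X. \<forall>n. \<forall>x\<in>simps A n. h n x = u n x"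
    show "has_lifts X A B"
      unfolding has_lifts_def lifting_def
    proof (intro ballI impI)
      fix u w assume u: "u \<in> shom A X" and w: "w \<in> shom B ?T"
      from R u obtain h where "h \<in> shom B X" "\<forall>n. \<forall>x\<in>simps A n. h n x = u n x" by blast
      then show "\<exists>h\<in>shom B X. scomp A h (sincl A) = u \<and> scomp B (to_terminal X) h = w"
        using c[OF u] p v[OF w] by blast
    qed
  qed
qed

lemma shom_in: "f \<in> shom X Y \<Longrightarrow> x \<in> simps X n \<Longrightarrow> f n x \<in> simps Y n"
  unfolding shom_def by blast

lemma shom_act:
  "f \<in> shom X Y \<Longrightarrow> \<theta> \<in> delta_hom m n \<Longrightarrow> x \<in> simps X n \<Longrightarrow>
    f m (act X m n \<theta> x) = act Y m n \<theta> (f n x)"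
  unfolding shom_def by blast

lemma shomI:
  assumes "simplicial_set X" "\<And>n x. x \<in> simps X n \<Longrightarrow> f n x \<in> simps Y n"
    "\<And>m n \<theta> x. \<theta> \<in> delta_hom m n \<Longrightarrow> x \<in> simps X n \<Longrightarrow> f m (act X m n \<theta> x) = act Y m n \<theta> (f n x)"
  shows "(\<lambda>n. \<lambda>x\<in>simps X n. f n x) \<in> shom X Y"
  using assms unfolding shom_def simplicial_set_def by (auto simp: Pi_iff)

lemma simplicial_set_act:
  "simplicial_set X \<Longrightarrow> \<theta> \<in> delta_hom m n \<Longrightarrow> x \<in> simps X n \<Longrightarrow> act X m n \<theta> x \<in> simps X m"
  unfolding simplicial_set_def by blast

lemma subcomplexD:
  assumes "subcomplex A X"
  shows "simplicial_set A" "simplicial_set X" "x \<in> simps A n \<Longrightarrow> x \<in> simps X n"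
    "\<theta> \<in> delta_hom m n \<Longrightarrow> x \<in> simps A n \<Longrightarrow> act A m n \<theta> x = act X m n \<theta> x"
proof -
  show A: "simplicial_set A" "simplicial_set X" "x \<in> simps A n \<Longrightarrow> x \<in> simps X n"
    using assms by (auto simp: subcomplex_def)
  assume t: "\<theta> \<in> delta_hom m n" "x \<in> simps A n"
  have "sincl A m (act A m n \<theta> x) = act X m n \<theta> (sincl A n x)"
    using assms t by (intro shom_act) (auto simp: subcomplex_def)
  then show "act A m n \<theta> x = act X m n \<theta> x"
    using t simplicial_set_act[OF A(1) t] by (simp add: sincl_def)
qed

text \<open>The interiors of the cells partition the simplices of \<open>K\<close> outside
  \<open>A\<close> (\<open>cover\<close>, \<open>avoid\<close>, \<open>inj\<close>), and
  \<open>C g\<close> meets only interiors of lower rank (\<open>attach\<close>). So \<open>K\<close>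
  is a relative cell complex over \<open>A\<close>, and the extension is chosen cell by cell along
  \<open>rank\<close>, without forming pushouts or a filtration.\<close>

lemma has_lifts_cell_complex:
  fixes X :: "'a sset" and K :: "'k sset" and B :: "'g \<Rightarrow> 'b sset" and rank :: "'g \<Rightarrow> nat"
  assumes X: "simplicial_set X" and AK: "subcomplex A K"
    and CB: "\<And>g. g \<in> G \<Longrightarrow> subcomplex (C g) (B g)"
    and lifts: "\<And>g. g \<in> G \<Longrightarrow> has_lifts X (C g) (B g)"
    and \<phi>: "\<And>g. g \<in> G \<Longrightarrow> \<phi> g \<in> shom (B g) K"
    and cover: "\<And>n z. z \<in> simps K n \<Longrightarrow> z \<notin> simps A n \<Longrightarrow>
      \<exists>g\<in>G. \<exists>b\<in>simps (B g) n - simps (C g) n. \<phi> g n b = z"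
    and avoid: "\<And>g n b. g \<in> G \<Longrightarrow> b \<in> simps (B g) n - simps (C g) n \<Longrightarrow> \<phi> g n b \<notin> simps A n"
    and inj: "\<And>g n b g' b'. g \<in> G \<Longrightarrow> g' \<in> G \<Longrightarrow> b \<in> simps (B g) n - simps (C g) n \<Longrightarrow>
      b' \<in> simps (B g') n - simps (C g') n \<Longrightarrow> \<phi> g n b = \<phi> g' n b' \<Longrightarrow> g = g' \<and> b = b'"
    and attach: "\<And>g n b g' b'. g \<in> G \<Longrightarrow> g' \<in> G \<Longrightarrow> b \<in> simps (C g) n \<Longrightarrow>
      b' \<in> simps (B g') n - simps (C g') n \<Longrightarrow> \<phi> g n b = \<phi> g' n b' \<Longrightarrow> rank g' < rank g"
  shows "has_lifts X A K"
  unfolding has_lifts_iff[OF X AK]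
proof
  fix u assume u: "u \<in> shom A X"
  note A = subcomplexD[OF AK]
  have "\<exists>cell. \<forall>n z. z \<in> simps K n \<and> z \<notin> simps A n \<longrightarrow> fst (cell n z) \<in> G \<and>
      snd (cell n z) \<in> simps (B (fst (cell n z))) n - simps (C (fst (cell n z))) n \<and>
      \<phi> (fst (cell n z)) n (snd (cell n z)) = z"
  proof -
    have "\<forall>n z. \<exists>gb. z \<in> simps K n \<and> z \<notin> simps A n \<longrightarrow> fst gb \<in> G \<and>
      snd gb \<in> simps (B (fst gb)) n - simps (C (fst gb)) n \<and> \<phi> (fst gb) n (snd gb) = z"
      using cover by (metis fst_conv snd_conv)
    then show ?thesis by metis
  qed
  then obtain cell where cell: "\<And>n z. z \<in> simps K n \<Longrightarrow> z \<notin> simps A n \<Longrightarrow> fst (cell n z) \<in> G \<and>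
      snd (cell n z) \<in> simps (B (fst (cell n z))) n - simps (C (fst (cell n z))) n \<and>
      \<phi> (fst (cell n z)) n (snd (cell n z)) = z" by blast
  \<comment> \<open>\<open>V H\<close> glues \<open>u\<close> with the maps \<open>H g\<close> on
    the interiors, where \<open>cell\<close> inverts \<phi>. A \<open>good\<close> choice at
    \<open>g\<close> is a simplicial map that agrees on \<open>C g\<close> with what has been
    assembled before.\<close>
  define V where "V H n z = (if z \<in> simps A n then u n z else H (fst (cell n z)) n (snd (cell n z)))"
    for H n z
  define good where "good H g h \<longleftrightarrow> (g \<in> G \<longrightarrow> h \<in> shom (B g) X \<and>
      (\<forall>n. \<forall>b\<in>simps (C g) n. h n b = V H n (\<phi> g n b)))" for H g h
  have \<phi>C: "\<phi> g n b \<in> simps K n" if "g \<in> G" "b \<in> simps (C g) n" for g n b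
    using shom_in[OF \<phi>] subcomplexD(3)[OF CB] that by blast
  have lower: "rank (fst (cell n (\<phi> g n b))) < rank g"
    if "g \<in> G" "b \<in> simps (C g) n" "\<phi> g n b \<notin> simps A n" for g n b
    using attach[OF that(1) _ that(2)] cell[OF \<phi>C[OF that(1,2)] that(3)] by metis
  \<comment> \<open>On \<open>C g\<close> this is goodness; on the interior, \<open>inj\<close>
    forces \<open>cell\<close> to return \<open>(g, b)\<close>.\<close>
  have V: "V H n (\<phi> g n b) = H g n b"
    if "good H g (H g)" "g \<in> G" "b \<in> simps (B g) n" for H g n b
  proof (cases "b \<in> simps (C g) n")
    case True
    then show ?thesis using that by (auto simp: good_def)
  next
    case False
    then have b: "b \<in> simps (B g) n - simps (C g) n" using that by blast
    have "cell n (\<phi> g n b) = (g, b)"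
      using cell[OF shom_in[OF \<phi>[OF that(2)] that(3)] avoid[OF that(2) b]] inj[OF _ that(2) _ b]
      by (metis prod.collapse)
    then show ?thesis using avoid[OF that(2) b] by (simp add: V_def)
  qed
  \<comment> \<open>A simplex outside \<open>A\<close> and all its images under simplicial operators
    lie in the image of a single \<phi>, so goodness of that one cell suffices. Hence this serves
    both during the recursion and after it.\<close>
  have V_in: "V H n z \<in> simps X n" and
    V_act: "V H m (act K m n \<theta> z) = act X m n \<theta> (V H n z)"
    if z: "z \<in> simps K n" and \<theta>: "\<theta> \<in> delta_hom m n"
      and H: "z \<notin> simps A n \<Longrightarrow> good H (fst (cell n z)) (H (fst (cell n z)))" for H m n \<theta> z
  proof -
    have "V H n z \<in> simps X n \<and> V H m (act K m n \<theta> z) = act X m n \<theta> (V H n z)"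
    proof (cases "z \<in> simps A n")
      case True
      have "act A m n \<theta> z \<in> simps A m" by (rule simplicial_set_act[OF A(1) \<theta> True])
      then show ?thesis using True shom_in[OF u] shom_act[OF u \<theta> True] A(4)[OF \<theta> True]
        by (simp add: V_def)
    next
      case False
      obtain g b where gb: "cell n z = (g, b)" by fastforce
      have g: "g \<in> G" and b: "b \<in> simps (B g) n" and zb: "\<phi> g n b = z"
        using cell[OF z False] gb by auto
      have good: "good H g (H g)" using H[OF False] gb by simp
      then have Hg: "H g \<in> shom (B g) X" using g by (simp add: good_def)
      have b': "act (B g) m n \<theta> b \<in> simps (B g) m"
        by (rule simplicial_set_act[OF subcomplexD(2)[OF CB[OF g]] \<theta> b])
      have "V H n z = H g n b" using V[OF good g b] zb by simp
      moreover have "V H m (act K m n \<theta> z) = H g m (act (B g) m n \<theta> b)"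
        using V[OF good g b'] shom_act[OF \<phi>[OF g] \<theta> b] zb by simp
      ultimately show ?thesis using shom_in[OF Hg b] shom_act[OF Hg \<theta> b] by simp
    qed
    then show "V H n z \<in> simps X n" "V H m (act K m n \<theta> z) = act X m n \<theta> (V H n z)" by auto
  qed
  have "\<exists>H. \<forall>g. good H g (H g)"
  proof (rule dependent_wf_choice[of "measure rank"])
    show "wf (measure rank)" by simp
  next
    fix f f' :: "'g \<Rightarrow> nat \<Rightarrow> 'b \<Rightarrow> 'a" and g h
    assume eq: "\<And>g'. (g', g) \<in> measure rank \<Longrightarrow> f g' = f' g'"
    \<comment> \<open>By \<open>lower\<close>, \<phi> sends \<open>C g\<close> into \<open>A\<close>
      or into interiors of smaller rank, so the requirement at \<open>g\<close> reads earlier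
      choices only.\<close>
    have "V f n (\<phi> g n b) = V f' n (\<phi> g n b)" if "g \<in> G" "b \<in> simps (C g) n" for n b
      using lower[OF that] eq by (simp add: V_def)
    then show "good f g h = good f' g h" by (auto simp: good_def)
  next
    fix g and H :: "'g \<Rightarrow> nat \<Rightarrow> 'b \<Rightarrow> 'a"
    assume IH: "\<And>g'. (g', g) \<in> measure rank \<Longrightarrow> good H g' (H g')"
    show "\<exists>h. good H g h"
    proof (cases "g \<in> G")
      case g: True
      note C = subcomplexD[OF CB[OF g]]
      define v where "v = (\<lambda>n. \<lambda>b\<in>simps (C g) n. V H n (\<phi> g n b))"
      have "v \<in> shom (C g) X" unfolding v_def
      proof (rule shomI[OF C(1)])
        fix n b assume b: "b \<in> simps (C g) n"
        have id: "(\<lambda>k\<in>{..n}. k) \<in> delta_hom n n" by (auto simp: delta_hom_def mono_on_def)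
        show "V H n (\<phi> g n b) \<in> simps X n"
          using V_in[OF \<phi>C[OF g b] id] IH lower[OF g b] by simp
      next
        fix m n \<theta> b assume t: "\<theta> \<in> delta_hom m n" and b: "b \<in> simps (C g) n"
        have "\<phi> g m (act (C g) m n \<theta> b) = act K m n \<theta> (\<phi> g n b)"
          using C(4)[OF t b] shom_act[OF \<phi>[OF g] t C(3)[OF b]] by simp
        then show "V H m (\<phi> g m (act (C g) m n \<theta> b)) = act X m n \<theta> (V H n (\<phi> g n b))"
          using V_act[OF \<phi>C[OF g b] t] IH lower[OF g b] by simp
      qed
      then obtain h where "h \<in> shom (B g) X" "\<forall>n. \<forall>b\<in>simps (C g) n. h n b = v n b"
        using lifts[OF g] unfolding has_lifts_iff[OF X CB[OF g]] by blast
      then show ?thesis by (auto simp: good_def v_def)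
    qed (simp add: good_def)
  qed
  then obtain H where H: "\<And>g. good H g (H g)" by blast
  define h where "h = (\<lambda>n. \<lambda>z\<in>simps K n. V H n z)"
  have "h \<in> shom K X" unfolding h_def
  proof (rule shomI[OF A(2)])
    fix n z assume z: "z \<in> simps K n"
    have id: "(\<lambda>k\<in>{..n}. k) \<in> delta_hom n n" by (auto simp: delta_hom_def mono_on_def)
    show "V H n z \<in> simps X n" using V_in[OF z id] H by blast
  next
    fix m n \<theta> z assume "\<theta> \<in> delta_hom m n" "z \<in> simps K n"
    then show "V H m (act K m n \<theta> z) = act X m n \<theta> (V H n z)" using V_act H by blast
  qed
  moreover have "\<forall>n. \<forall>z\<in>simps A n. h n z = u n z" using A(3) by (auto simp: h_def V_def)
  ultimately show "\<exists>h\<in>shom K X. \<forall>n. \<forall>z\<in>simps A n. h n z = u n z" by blast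
qed

subsection \<open>Simplices of the isoplex and of \<open>J \<times> \<Delta>[N]\<close>\<close>

text \<open>Every hom-set of the free-living isomorphism is a singleton, so a simplex of \<open>J\<close> is determined by
  its object part.\<close>

lemma J_simplex_eqI: "fst p = fst q \<Longrightarrow> p = q" for p q :: J_simplex
  by (simp add: prod_eq_iff fun_eq_iff)

text \<open>The arrow part takes values in \<open>unit\<close>, so the constant function also
  matches the default \<open>undefined\<close> that \<open>nerve\<close> prescribes outside its
  range.\<close>

definition Jsimp :: "(nat \<Rightarrow> nat) \<Rightarrow> J_simplex" where
  "Jsimp F = (F, \<lambda>i j. ())"

lemma fst_Jsimp [simp]: "fst (Jsimp F) = F"
  by (simp add: Jsimp_def)

lemma in_simps_J_iff: "p \<in> simps J m \<longleftrightarrow> fst p \<in> {..m} \<rightarrow>\<^sub>E {0, 1}"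
  by (cases p) (simp add: simps_J)

lemma act_J: "act J l m \<theta> p = Jsimp (compose {..l} (fst p) \<theta>)"
  by (rule J_simplex_eqI, cases p) (simp add: J_def nerve_def)

lemma J_vertex_eq: "J_vertex a = Jsimp (\<lambda>k\<in>{..0}. a)"
  by (rule J_simplex_eqI) (simp add: J_vertex_def)

lemma in_simps_prism_iff:
  "z \<in> simps (sprod J (Delta N)) m \<longleftrightarrow>
    fst (fst z) \<in> {..m} \<rightarrow>\<^sub>E {0, 1} \<and> snd z \<in> delta_hom m N"
  by (cases z) (simp add: sprod_def in_simps_J_iff Delta_def)

lemma act_prism:
  "act (sprod J (Delta N)) l m \<theta> z =
    (Jsimp (compose {..l} (fst (fst z)) \<theta>), compose {..l} (snd z) \<theta>)"
  by (cases z) (simp add: sprod_def act_J Delta_def)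

lemma in_simps_point_J_iff:
  assumes "p \<in> simps J m"
  shows "p \<in> simps (point_subcomplex J (J_vertex 0)) m \<longleftrightarrow> (\<forall>k\<le>m. fst p k = 0)"
proof -
  have "p = act J m 0 (\<lambda>k\<in>{..m}. 0) (J_vertex 0) \<longleftrightarrow>
      fst p = compose {..m} (\<lambda>k\<in>{..0::nat}. 0) (\<lambda>k\<in>{..m}. 0)"
    unfolding act_J J_vertex_eq fst_Jsimp
  proof
    assume "fst p = compose {..m} (\<lambda>k\<in>{..0::nat}. 0) (\<lambda>k\<in>{..m}. 0)"
    then show "p = Jsimp (compose {..m} (\<lambda>k\<in>{..0::nat}. 0) (\<lambda>k\<in>{..m}. 0))"
      by (intro J_simplex_eqI) (simp only: fst_Jsimp)
  qed (simp only: fst_Jsimp)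
  also have "\<dots> \<longleftrightarrow> fst p = (\<lambda>k\<in>{..m}. 0)"
    by (simp add: compose_def restrict_def cong: if_cong)
  also have "\<dots> \<longleftrightarrow> (\<forall>k\<le>m. fst p k = 0)"
    using assms unfolding in_simps_J_iff by (auto simp: fun_eq_iff PiE_def extensional_def)
  finally show ?thesis by (simp add: point_subcomplex_def)
qed

text \<open>Reduces the union to vertex labels. The complement, which has to be filled by cells,
  consists of the simplices that carry a label 1 somewhere and surject onto \<Delta>[N].\<close>

lemma in_simps_pushout_product_iff:
  "z \<in> simps (J_pushout_product N) m \<longleftrightarrow> z \<in> simps (sprod J (Delta N)) m \<and>
    ((\<forall>k\<le>m. fst (fst z) k = 0) \<or> snd z ` {..m} \<noteq> {..N})"
proof -
  have "z \<in> simps (J_pushout_product N) m \<longleftrightarrow> z \<in> simps (sprod J (Delta N)) m \<and>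
    (fst z \<in> simps (point_subcomplex J (J_vertex 0)) m \<or> snd z ` {..m} \<noteq> {..N})"
    using simps_point_J_subset[of m]
    by (cases z) (auto simp: J_pushout_product_def sunion_def sprod_def Delta_def boundary_Delta_def)
  moreover have "fst z \<in> simps J m" if "z \<in> simps (sprod J (Delta N)) m"
    using that by (simp add: in_simps_J_iff in_simps_prism_iff)
  ultimately show ?thesis using in_simps_point_J_iff by blast
qed

lemma vertex_prism:
  assumes "k \<le> m"
  shows "vertex (sprod J (Delta N)) m k z =
    (Jsimp (\<lambda>l\<in>{..0}. fst (fst z) k), \<lambda>l\<in>{..0}. snd z k)"
  by (auto simp: vertex_def act_prism compose_def fun_eq_iff intro!: arg_cong[where f = Jsimp])

lemma const0_eq_iff: "(\<lambda>l\<in>{..0::nat}. a) = (\<lambda>l\<in>{..0}. b) \<longleftrightarrow> a = b"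
  by (auto dest: fun_cong[where x = 0])

lemma Jsimp_eq_iff: "Jsimp F = Jsimp F' \<longleftrightarrow> F = F'"
  by (simp add: Jsimp_def)

lemma in_simps_widening_Delta_iff:
  "z \<in> simps (widening {Delta_vertex i} (Delta N)) m \<longleftrightarrow> z \<in> simps (sprod J (Delta N)) m \<and>
    (\<forall>k\<le>m. fst (fst z) k = 1 \<longrightarrow> snd z k = i)"
proof -
  have "vertex (sprod J (Delta N)) m k z
      \<in> {J_vertex 0} \<times> simps (Delta N) 0 \<union> {J_vertex 1} \<times> {Delta_vertex i} \<longleftrightarrow>
      (fst (fst z) k = 1 \<longrightarrow> snd z k = i)"
    if k: "k \<le> m" and z: "z \<in> simps (sprod J (Delta N)) m" for k
  proof -
    have "fst (fst z) k \<in> {0, 1}" "snd z k \<le> N"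
      using k z unfolding in_simps_prism_iff delta_hom_def by auto
    moreover from this(2) have "(\<lambda>l\<in>{..0}. snd z k) \<in> simps (Delta N) 0"
      unfolding Delta_def by (simp del: atMost_0 add: delta_hom_const)
    ultimately show ?thesis
      unfolding vertex_prism[OF k] J_vertex_eq Delta_vertex_def
      by (auto simp: Jsimp_eq_iff const0_eq_iff simp del: atMost_0)
  qed
  then show ?thesis
    unfolding widening_def full_subcomplex_def by auto
qed

lemma in_simps_isoplex_iff:
  "z \<in> simps (isoplex i (Suc N)) m \<longleftrightarrow> z \<in> simps (sprod J (Delta N)) m \<and>
    (\<forall>k\<le>m. fst (fst z) k = 1 \<longrightarrow> snd z k = i)"
  unfolding isoplex_def by (simp add: in_simps_widening_Delta_iff)

lemma act_isoplex: "act (isoplex i (Suc N)) = act (sprod J (Delta N))"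
  by (simp add: isoplex_def widening_def full_subcomplex_def)

text \<open>Both pieces of the union are cut out of the isoplex vertexwise, by the same condition
  that cuts the pushout-product out of the prism.\<close>

lemma in_simps_iso_horn_iff:
  "z \<in> simps (iso_horn i (Suc N)) m \<longleftrightarrow> z \<in> simps (isoplex i (Suc N)) m \<and>
    ((\<forall>k\<le>m. fst (fst z) k = 0) \<or> snd z ` {..m} \<noteq> {..N})"
proof -
  let ?D = "Delta N" and ?B = "boundary_Delta N"
  have v: "vertex (sprod J ?B) m k x = vertex (sprod J ?D) m k x" for k x
    by (simp add: vertex_def sprod_def act_boundary_Delta)
  have 1: "z \<in> simps (widening ({Delta_vertex i} \<inter> simps ?B 0) ?B) m \<longleftrightarrow>
      z \<in> simps (widening {Delta_vertex i} ?D) m \<and> snd z ` {..m} \<noteq> {..N}"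
  proof (cases "z \<in> simps (sprod J ?B) m")
    case True
    then have z: "z \<in> simps (sprod J ?D) m" "snd z ` {..m} \<noteq> {..N}" "snd z \<in> simps ?B m"
      by (auto simp: sprod_def boundary_Delta_def Delta_def)
    \<comment> \<open>The vertices of a boundary simplex are boundary vertices, so the vertex
      conditions \<open>?P\<close> and \<open>?Q\<close> agree on it.\<close>
    have b: "snd (vertex (sprod J ?B) m k z) \<in> simps ?B 0" if "k \<le> m" for k
      using simplicial_set_act[OF simplicial_set_boundary_Delta delta_hom_const[OF that] z(3)]
      by (simp add: vertex_def sprod_def del: atMost_0)
    have d: "snd (vertex (sprod J ?B) m k z) \<in> simps ?D 0" if "k \<le> m" for k
      using b[OF that] simps_boundary_Delta_subset by blast
    let ?P = "\<lambda>k. vertex (sprod J ?D) m k z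
      \<in> {J_vertex 0} \<times> simps ?B 0 \<union> {J_vertex 1} \<times> ({Delta_vertex i} \<inter> simps ?B 0)"
    let ?Q = "\<lambda>k. vertex (sprod J ?D) m k z
      \<in> {J_vertex 0} \<times> simps ?D 0 \<union> {J_vertex 1} \<times> {Delta_vertex i}"
    have "?P k \<longleftrightarrow> ?Q k" if "k \<le> m" for k
      using b[OF that] d[OF that] unfolding v by (cases "vertex (sprod J ?D) m k z") auto
    moreover have "z \<in> simps (widening ({Delta_vertex i} \<inter> simps ?B 0) ?B) m \<longleftrightarrow> (\<forall>k\<le>m. ?P k)"
      using True by (simp add: widening_def full_subcomplex_def v)
    moreover have "z \<in> simps (widening {Delta_vertex i} ?D) m \<longleftrightarrow> (\<forall>k\<le>m. ?Q k)"
      using z(1) by (simp add: widening_def full_subcomplex_def)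
    ultimately show ?thesis using z(2) by blast
  next
    case False
    then show ?thesis
      by (auto simp: widening_def full_subcomplex_def sprod_def boundary_Delta_def Delta_def)
  qed
  have 2: "z \<in> simps (sprod (point_subcomplex J (J_vertex 0)) ?D) m \<longleftrightarrow>
      z \<in> simps (widening {Delta_vertex i} ?D) m \<and> (\<forall>k\<le>m. fst (fst z) k = 0)"
  proof (cases "z \<in> simps (sprod J ?D) m")
    case True
    then have "fst z \<in> simps J m" "snd z \<in> simps ?D m" by (auto simp: sprod_def)
    then show ?thesis using True in_simps_point_J_iff[of "fst z" m]
      unfolding in_simps_widening_Delta_iff by (auto simp: sprod_def mem_Times_iff)
  next
    case False
    then show ?thesis using simps_point_J_subset[of m]
      unfolding in_simps_widening_Delta_iff by (auto simp: sprod_def mem_Times_iff)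
  qed
  show ?thesis unfolding iso_horn_def isoplex_def sunion_def using 1 2 by auto
qed


section \<open>The iso-horn inclusion as a retract of the pushout-product\<close>

text \<open>Extend the composite of \<open>u\<close> with \<open>r\<close> from \<open>A\<close> to
  \<open>K\<close> and restrict to \<open>B\<close>; since \<open>r\<close> fixes \<open>C\<close>,
  the result extends \<open>u\<close>.\<close>

lemma has_lifts_retract:
  assumes X: "simplicial_set X" and CB: "subcomplex C B" and AK: "subcomplex A K"
    and BK: "subcomplex B K" and r: "r \<in> shom K B"
    and retraction: "\<And>n x. x \<in> simps B n \<Longrightarrow> r n x = x"
    and rA: "\<And>n x. x \<in> simps A n \<Longrightarrow> r n x \<in> simps C n"
    and CA: "\<And>n. simps C n \<subseteq> simps A n"
    and lifts: "has_lifts X A K"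
  shows "has_lifts X C B"
  unfolding has_lifts_iff[OF X CB]
proof
  fix u assume u: "u \<in> shom C X"
  note A = subcomplexD[OF AK] and B = subcomplexD[OF BK] and C = subcomplexD[OF CB]
  have "(\<lambda>n. \<lambda>x\<in>simps A n. u n (r n x)) \<in> shom A X"
  proof (rule shomI[OF A(1)])
    fix n x assume "x \<in> simps A n"
    then show "u n (r n x) \<in> simps X n" using shom_in[OF u] rA by blast
  next
    fix m n \<theta> x assume t: "\<theta> \<in> delta_hom m n" and x: "x \<in> simps A n"
    show "u m (r m (act A m n \<theta> x)) = act X m n \<theta> (u n (r n x))"
      using A(4)[OF t x] shom_act[OF r t A(3)[OF x]] C(4)[OF t rA[OF x]] shom_act[OF u t rA[OF x]]
      by simp
  qed
  then obtain h where h: "h \<in> shom K X" "\<forall>n. \<forall>x\<in>simps A n. h n x = u n (r n x)"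
    using lifts unfolding has_lifts_iff[OF X AK] by fastforce
  have "(\<lambda>n. \<lambda>x\<in>simps B n. h n x) \<in> shom B X"
  proof (rule shomI[OF B(1)])
    fix n x assume "x \<in> simps B n"
    then show "h n x \<in> simps X n" using shom_in[OF h(1)] B(3) by blast
  next
    fix m n \<theta> x assume t: "\<theta> \<in> delta_hom m n" and x: "x \<in> simps B n"
    show "h m (act B m n \<theta> x) = act X m n \<theta> (h n x)"
      using B(4)[OF t x] shom_act[OF h(1) t B(3)[OF x]] by simp
  qed
  moreover have "\<forall>n. \<forall>x\<in>simps C n. (\<lambda>x\<in>simps B n. h n x) x = u n x"
    using h(2) CA C(3) retraction by (simp add: subset_iff)
  ultimately show "\<exists>h\<in>shom B X. \<forall>n. \<forall>x\<in>simps C n. h n x = u n x"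
    by (intro bexI[where x = "\<lambda>n. \<lambda>x\<in>simps B n. h n x"])
qed

lemma delta_hom_le: "d \<in> delta_hom m n \<Longrightarrow> k \<le> m \<Longrightarrow> d k \<le> n"
  by (auto simp: delta_hom_def)

lemma isoplex_subcomplex: "subcomplex (isoplex i (Suc N)) (sprod J (Delta N))"
proof (rule subcomplexI)
  show "simplicial_set (isoplex i (Suc N))" using iso_horn_subcomplex by (rule subcomplexD)
  show "simplicial_set (sprod J (Delta N))" by (intro simplicial_set_intros)
qed (auto simp: in_simps_isoplex_iff act_isoplex)

lemma has_lifts_iso_horn_if_pushout_product:
  assumes X: "simplicial_set X" and lifts: "has_lifts X (J_pushout_product N) (sprod J (Delta N))"
  shows "has_lifts X (iso_horn i (Suc N)) (isoplex i (Suc N))"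
proof -
  let ?K = "sprod J (Delta N)"
  \<comment> \<open>Relabelling vertex by vertex is simplicial, because each sequence of objects of
    the free-living isomorphism underlies exactly one simplex of \<open>J\<close>.\<close>
  define r where "r = (\<lambda>m. \<lambda>z\<in>simps ?K m.
    (Jsimp (\<lambda>k\<in>{..m}. if snd z k = i then fst (fst z) k else 0), snd z))"
  have K: "simplicial_set ?K" by (intro simplicial_set_intros)
  show ?thesis
  proof (rule has_lifts_retract[OF X iso_horn_subcomplex J_pushout_product_subcomplex
        isoplex_subcomplex _ _ _ _ lifts])
    show "r \<in> shom ?K (isoplex i (Suc N))" unfolding r_def
    proof (rule shomI[OF K])
      fix n z assume "z \<in> simps ?K n"
      then show "(Jsimp (\<lambda>k\<in>{..n}. if snd z k = i then fst (fst z) k else 0), snd z)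
          \<in> simps (isoplex i (Suc N)) n"
        unfolding in_simps_isoplex_iff in_simps_prism_iff by (auto simp: PiE_iff)
    next
      fix m n \<theta> z assume t: "\<theta> \<in> delta_hom m n"
      show "(Jsimp (\<lambda>k\<in>{..m}. if snd (act ?K m n \<theta> z) k = i
            then fst (fst (act ?K m n \<theta> z)) k else 0), snd (act ?K m n \<theta> z)) =
          act (isoplex i (Suc N)) m n \<theta>
            (Jsimp (\<lambda>k\<in>{..n}. if snd z k = i then fst (fst z) k else 0), snd z)"
        using delta_hom_le[OF t]
        by (auto simp: act_isoplex act_prism compose_def fun_eq_iff Jsimp_eq_iff)
    qed
  next
    fix n z assume z: "z \<in> simps (isoplex i (Suc N)) n"
    then have "fst (fst z) \<in> {..n} \<rightarrow>\<^sub>E {0, 1}" "\<And>k. k \<le> n \<Longrightarrow> fst (fst z) k = 1 \<Longrightarrow> snd z k = i"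
      by (auto simp: in_simps_isoplex_iff in_simps_prism_iff)
    then have "(\<lambda>k\<in>{..n}. if snd z k = i then fst (fst z) k else 0) = fst (fst z)"
      by (fastforce simp: fun_eq_iff PiE_iff extensional_def)
    then have "Jsimp (\<lambda>k\<in>{..n}. if snd z k = i then fst (fst z) k else 0) = fst z"
      by (intro J_simplex_eqI) simp
    then show "r n z = z" using z by (simp add: r_def in_simps_isoplex_iff)
  next
    \<comment> \<open>The map leaves the \<Delta>[N]-coordinate alone and never raises a label, so
      each of the two alternatives for \<open>z\<close> survives.\<close>
    fix n z assume "z \<in> simps (J_pushout_product N) n"
    then show "r n z \<in> simps (iso_horn i (Suc N)) n"
      unfolding in_simps_pushout_product_iff in_simps_iso_horn_iff in_simps_isoplex_iff
      by (auto simp: r_def in_simps_prism_iff PiE_iff)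
  next
    show "simps (iso_horn i (Suc N)) n \<subseteq> simps (J_pushout_product N) n" for n
      by (auto simp: in_simps_pushout_product_iff in_simps_iso_horn_iff in_simps_isoplex_iff)
  qed
qed

subsection \<open>Nondegenerate sequences\<close>

text \<open>Existence half of the Eilenberg-Zilber factorization, for a bare sequence: collapse the
  runs of equal consecutive terms. Inductively, a new term either prolongs the last run or opens a
  new position.\<close>

lemma degeneracy_exists:
  fixes w :: "nat \<Rightarrow> 'b"
  shows "\<exists>d \<tau>. d (0::nat) = (0::nat) \<and> (\<forall>k<m. d (Suc k) = d k \<or> d (Suc k) = Suc (d k)) \<and>
    (\<forall>k\<le>m. d k \<le> d m \<and> \<tau> (d k) = w k) \<and> (\<forall>q<d m. \<tau> q \<noteq> \<tau> (Suc q))"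
proof (induction m)
  case 0
  then show ?case by (intro exI[of _ "\<lambda>_. 0"] exI[of _ "\<lambda>_. w 0"]) auto
next
  case (Suc m)
  then obtain d \<tau> where d: "d 0 = 0" "\<And>k. k < m \<Longrightarrow> d (Suc k) = d k \<or> d (Suc k) = Suc (d k)"
    "\<And>k. k \<le> m \<Longrightarrow> d k \<le> d m \<and> \<tau> (d k) = w k" "\<And>q. q < d m \<Longrightarrow> \<tau> q \<noteq> \<tau> (Suc q)"
    by blast
  show ?case
  proof (cases "w (Suc m) = w m")
    case True
    then show ?thesis using d
      by (intro exI[of _ "d(Suc m := d m)"] exI[of _ \<tau>]) (auto simp: less_Suc_eq le_Suc_eq)
  next
    case False
    \<comment> \<open>The new position is not yet a value of \<open>d\<close>, so updating \<tau>
      there disturbs no earlier term.\<close>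
    have "d k \<noteq> Suc (d m)" if "k \<le> m" for k using d(3)[OF that] by auto
    then show ?thesis using d False
      by (intro exI[of _ "d(Suc m := Suc (d m))"] exI[of _ "\<tau>(Suc (d m) := w (Suc m))"])
        (auto simp: less_Suc_eq le_Suc_eq)
  qed
qed

lemma unit_steps_image:
  fixes d :: "nat \<Rightarrow> nat"
  assumes "d 0 = 0" "\<And>k. k < m \<Longrightarrow> d (Suc k) = d k \<or> d (Suc k) = Suc (d k)"
  shows "d ` {..m} = {..d m}"
  using assms(2)
proof (induction m)
  case (Suc m)
  then have "d ` {..m} = {..d m}" by simp
  moreover have "d ` {..Suc m} = insert (d (Suc m)) (d ` {..m})" by (simp add: atMost_Suc)
  moreover have "d (Suc m) = d m \<or> d (Suc m) = Suc (d m)" using Suc.prems by simp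
  ultimately show ?case by (auto simp: atMost_Suc)
qed (simp add: assms(1))

lemma delta_hom_mono: "d \<in> delta_hom m n \<Longrightarrow> k \<le> l \<Longrightarrow> l \<le> m \<Longrightarrow> d k \<le> d l"
  by (auto simp: delta_hom_def mono_on_def)

lemma delta_hom_surj_steps:
  assumes d: "d \<in> delta_hom m n" and surj: "d ` {..m} = {..n}"
  shows "d 0 = 0" "d m = n" "k < m \<Longrightarrow> d (Suc k) = d k \<or> d (Suc k) = Suc (d k)"
proof -
  obtain l where "l \<le> m" "d l = 0" using surj by (metis atMost_iff imageE le0)
  then show "d 0 = 0" using delta_hom_mono[OF d, of 0 l] by simp
  obtain l where "l \<le> m" "d l = n" using surj by (metis atMost_iff imageE order_refl)
  then show "d m = n" using delta_hom_mono[OF d, of l m] delta_hom_le[OF d, of m] by simp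
  assume k: "k < m"
  show "d (Suc k) = d k \<or> d (Suc k) = Suc (d k)"
  proof (rule ccontr)
    assume "\<not> ?thesis"
    then have *: "Suc (d k) < d (Suc k)" using delta_hom_mono[OF d, of k "Suc k"] k by simp
    then have "Suc (d k) \<le> n" using delta_hom_le[OF d, of "Suc k"] k by simp
    then obtain l where l: "l \<le> m" "d l = Suc (d k)" using surj by (metis atMost_iff imageE)
    show False
      using delta_hom_mono[OF d, of l k] delta_hom_mono[OF d, of "Suc k" l] l k *
      by (cases "l \<le> k") auto
  qed
qed

text \<open>An advance of \<open>d\<close> is by exactly one, and \<tau> has no consecutive repeats;
  so the repetitions of the composite sequence reveal those of \<open>d\<close>.\<close>

lemma degeneracy_step:
  assumes "d \<in> delta_hom m M" "d ` {..m} = {..M}" "\<And>q. q < M \<Longrightarrow> \<tau> q \<noteq> \<tau> (Suc q)" "k < m"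
  shows "\<tau> (d (Suc k)) = \<tau> (d k) \<longleftrightarrow> d (Suc k) = d k"
proof (cases "d (Suc k) = d k")
  case False
  then have "d (Suc k) = Suc (d k)" using delta_hom_surj_steps(3)[OF assms(1,2,4)] by simp
  moreover from this have "d k < M" using delta_hom_le[OF assms(1), of "Suc k"] assms(4) by simp
  ultimately show ?thesis using assms(3)[of "d k"] by auto
qed simp

text \<open>Uniqueness half of Eilenberg-Zilber: both degeneracies start at 0 and advance at the
  places where the common sequence changes.\<close>

lemma degeneracy_unique:
  assumes d: "d \<in> delta_hom m M" "d ` {..m} = {..M}" "\<And>q. q < M \<Longrightarrow> \<tau> q \<noteq> \<tau> (Suc q)"
    and d': "d' \<in> delta_hom m M'" "d' ` {..m} = {..M'}" "\<And>q. q < M' \<Longrightarrow> \<tau>' q \<noteq> \<tau>' (Suc q)"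
    and eq: "\<And>k. k \<le> m \<Longrightarrow> \<tau> (d k) = \<tau>' (d' k)"
  shows "M = M'" "d = d'" "q \<le> M \<Longrightarrow> \<tau> q = \<tau>' q"
proof -
  have k: "d k = d' k" if "k \<le> m" for k
    using that
  proof (induction k)
    case 0
    then show ?case using delta_hom_surj_steps(1)[OF d(1,2)] delta_hom_surj_steps(1)[OF d'(1,2)] by simp
  next
    case (Suc k)
    have "\<tau> (d (Suc k)) = \<tau> (d k) \<longleftrightarrow> d (Suc k) = d k"
      using Suc.prems by (intro degeneracy_step[of d m M \<tau> k, OF d]) auto
    moreover have "\<tau>' (d' (Suc k)) = \<tau>' (d' k) \<longleftrightarrow> d' (Suc k) = d' k"
      using Suc.prems by (intro degeneracy_step[of d' m M' \<tau>' k, OF d']) auto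
    moreover have "d (Suc k) = d k \<or> d (Suc k) = Suc (d k)"
      using Suc.prems by (intro delta_hom_surj_steps(3)[OF d(1,2)]) simp
    moreover have "d' (Suc k) = d' k \<or> d' (Suc k) = Suc (d' k)"
      using Suc.prems by (intro delta_hom_surj_steps(3)[OF d'(1,2)]) simp
    moreover have "\<tau> (d k) = \<tau>' (d' k)" "\<tau> (d (Suc k)) = \<tau>' (d' (Suc k))"
      using eq[of k] eq[of "Suc k"] Suc.prems by simp_all
    moreover have "d k = d' k" using Suc by simp
    ultimately show ?case by metis
  qed
  show "M = M'" using k[of m] delta_hom_surj_steps(2)[OF d(1,2)] delta_hom_surj_steps(2)[OF d'(1,2)] by simp
  show "d = d'"
  proof
    fix l show "d l = d' l"
      using k[of l] d(1) d'(1) by (cases "l \<le> m") (auto simp: delta_hom_def PiE_iff extensional_def)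
  qed
  assume "q \<le> M"
  then obtain l where "l \<le> m" "d l = q" using d(2) by (metis atMost_iff imageE)
  then show "\<tau> q = \<tau>' q" using eq[of l] k[of l] by simp
qed

text \<open>If a sequence factors through a monotone \<open>d\<close>, then so does its degeneracy
  \<open>d'\<close>, which maps the image of \<open>d\<close> onto all of \<open>{..M}\<close>. This
  bounds the dimension of the cell that contains a given horn simplex.\<close>

lemma degeneracy_card:
  assumes d: "d \<in> delta_hom m P"
    and d': "d' \<in> delta_hom m M" "d' ` {..m} = {..M}" "\<And>q. q < M \<Longrightarrow> \<tau> q \<noteq> \<tau> (Suc q)"
    and factor: "\<And>k. k \<le> m \<Longrightarrow> \<tau> (d' k) = \<psi> (d k)"
  shows "M < card (d ` {..m})"
proof -
  \<comment> \<open>Between two equal values \<open>d\<close> is constant by monotonicity, hence so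
    is the sequence, and then \<open>d'\<close> by \<open>degeneracy_step\<close>.\<close>
  have const: "d' (k + a) = d' k" if "k + a \<le> m" "d (k + a) = d k" for k a
    using that
  proof (induction a)
    case (Suc a)
    have "d (k + a) = d k"
      using delta_hom_mono[OF d, of k "k + a"] delta_hom_mono[OF d, of "k + a" "k + Suc a"] Suc.prems
      by simp
    moreover from this have "\<tau> (d' (Suc (k + a))) = \<tau> (d' (k + a))"
      using factor[of "k + a"] factor[of "k + Suc a"] Suc.prems by simp
    moreover have "\<tau> (d' (Suc (k + a))) = \<tau> (d' (k + a)) \<longleftrightarrow> d' (Suc (k + a)) = d' (k + a)"
      using Suc.prems by (intro degeneracy_step[of d' m M \<tau> "k + a", OF d']) auto
    moreover have "d' (k + a) = d' k" using Suc.prems calculation(1) by (intro Suc.IH) simp_all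
    ultimately show ?case by (metis add_Suc_right)
  qed simp
  have wd: "d' k = d' l" if "k \<le> m" "l \<le> m" "d k = d l" for k l
  proof (cases "k \<le> l")
    case True
    then show ?thesis using const[of k "l - k"] that by simp
  next
    case False
    then show ?thesis using const[of l "k - l"] that by simp
  qed
  define g where "g q = d' (SOME k. k \<le> m \<and> d k = q)" for q
  have "g (d k) = d' k" if "k \<le> m" for k
  proof -
    have "(SOME l. l \<le> m \<and> d l = d k) \<le> m \<and> d (SOME l. l \<le> m \<and> d l = d k) = d k"
      by (rule someI[of "\<lambda>l. l \<le> m \<and> d l = d k" k]) (simp add: that)
    then show ?thesis unfolding g_def using that by (intro wd) auto
  qed
  then have "g ` d ` {..m} = {..M}"
    using d'(2) by (simp add: image_image)
  then have "card {..M} \<le> card (d ` {..m})" using card_image_le[of "d ` {..m}" g] by simp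
  then show ?thesis by simp
qed

subsection \<open>The cells of \<open>J \<times> \<Delta>[N]\<close>\<close>

text \<open>The cell \<open>(j, M, t, c)\<close> is the nondegenerate \<open>M\<close>-simplex \<open>(t, c)\<close> of the widening of \<open>\<Delta>[N]\<close> at
  \<open>{0..<j}\<close>. The vertex \<open>(0, j)\<close> occurs in it exactly once, at the position \<open>pivot j c\<close>; the cell is
  the isoplex with pivot there, whose extra vertex is sent to \<open>(1, j)\<close>.\<close>

type_synonym cell = "nat \<times> nat \<times> (nat \<Rightarrow> nat) \<times> (nat \<Rightarrow> nat)"

definition prism_cells :: "nat \<Rightarrow> cell set" where
  "prism_cells N = {(j, M, t, c). j \<le> N \<and> t \<in> {..M} \<rightarrow>\<^sub>E {0, 1} \<and> c \<in> delta_hom M N \<and>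
     c ` {..M} = {..N} \<and> (\<forall>p\<le>M. t p = 1 \<longrightarrow> c p < j) \<and>
     (\<forall>p<M. (t p, c p) \<noteq> (t (Suc p), c (Suc p)))}"

text \<open>Beyond \<open>M\<close> the function \<open>c\<close> is \<open>undefined\<close>, which
  may happen to equal \<open>j\<close>; the least position is safe, because in a cell
  \<open>j\<close> is attained within the range.\<close>

definition pivot :: "nat \<Rightarrow> (nat \<Rightarrow> nat) \<Rightarrow> nat" where
  "pivot j c = (LEAST p. c p = j)"

definition cell_dom :: "cell \<Rightarrow> (J_simplex \<times> (nat \<Rightarrow> nat)) sset" where
  "cell_dom = (\<lambda>(j, M, t, c). isoplex (pivot j c) (Suc M))"

definition cell_horn :: "cell \<Rightarrow> (J_simplex \<times> (nat \<Rightarrow> nat)) sset" where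
  "cell_horn = (\<lambda>(j, M, t, c). iso_horn (pivot j c) (Suc M))"

definition cell_map :: "cell \<Rightarrow> (J_simplex \<times> (nat \<Rightarrow> nat), J_simplex \<times> (nat \<Rightarrow> nat)) smap" where
  "cell_map = (\<lambda>(j, M, t, c) m. \<lambda>b\<in>simps (isoplex (pivot j c) (Suc M)) m.
     (Jsimp (\<lambda>k\<in>{..m}. if fst (fst b) k = 1 then 1 else t (snd b k)), compose {..m} c (snd b)))"

lemma
  assumes "(j, M, t, c) \<in> prism_cells N"
  shows pivot_le: "pivot j c \<le> M" and c_pivot: "c (pivot j c) = j"
proof -
  have "j \<in> c ` {..M}" using assms by (auto simp: prism_cells_def)
  then obtain p where p: "p \<le> M" "c p = j" by blast
  then show "pivot j c \<le> M" unfolding pivot_def using Least_le[of "\<lambda>p. c p = j" p] by simp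
  show "c (pivot j c) = j" unfolding pivot_def using p(2) by (rule LeastI)
qed

text \<open>Two occurrences of \<open>j\<close> would by monotonicity give two adjacent ones, both
  with label 0 since label 1 requires a value below \<open>j\<close>. This contradicts
  nondegeneracy.\<close>

lemma pivot_unique:
  assumes g: "(j, M, t, c) \<in> prism_cells N" and p: "p \<le> M" "c p = j"
  shows "p = pivot j c"
proof (rule ccontr)
  define i where "i = pivot j c"
  have i: "c i = j" using c_pivot[OF g] by (simp add: i_def)
  assume "p \<noteq> pivot j c"
  moreover have "i \<le> p" unfolding i_def pivot_def using p(2) by (rule Least_le)
  ultimately have ip: "i < p" by (simp add: i_def)
  have c: "c \<in> delta_hom M N" and t: "t \<in> {..M} \<rightarrow>\<^sub>E {0, 1}" "\<And>p. p \<le> M \<Longrightarrow> t p = 1 \<Longrightarrow> c p < j"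
    and ne: "(t i, c i) \<noteq> (t (Suc i), c (Suc i))"
    using g p ip by (auto simp: prism_cells_def)
  have "c (Suc i) = j"
    using delta_hom_mono[OF c, of i "Suc i"] delta_hom_mono[OF c, of "Suc i" p] i p ip by simp
  moreover have "t q = 0" if "q \<le> M" "c q = j" for q
    using t(1) t(2)[of q] that by (auto simp: PiE_iff)
  ultimately show False using ne i ip p by simp
qed

text \<open>The last three facts read a cell off an image simplex: no label 1 lies beyond
  \<open>j\<close>, the extra vertex of the isoplex is what lands on \<open>(1, j)\<close>, and
  lowering \<open>(1, j)\<close> to \<open>(0, j)\<close> gives back \<open>(t, c)\<close> along
  \<open>snd b\<close>.\<close>

lemma cell_map_simps:
  assumes g: "(j, M, t, c) \<in> prism_cells N" and b: "b \<in> simps (isoplex (pivot j c) (Suc M)) m"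
    and k: "k \<le> m"
  defines "z \<equiv> cell_map (j, M, t, c) m b"
  shows "snd z k = c (snd b k)"
    and "fst (fst z) k = (if fst (fst b) k = 1 then 1 else t (snd b k))"
    and "fst (fst z) k = 1 \<Longrightarrow> snd z k \<le> j"
    and "fst (fst b) k = 1 \<longleftrightarrow> fst (fst z) k = 1 \<and> snd z k = j"
    and "(if snd z k = j then 0 else fst (fst z) k) = t (snd b k)"
proof -
  show z: "snd z k = c (snd b k)"
    "fst (fst z) k = (if fst (fst b) k = 1 then 1 else t (snd b k))"
    using b k by (simp_all add: z_def cell_map_def compose_def)
  have d: "snd b k \<le> M" and s: "fst (fst b) k = 1 \<Longrightarrow> snd b k = pivot j c"
    using b k by (auto simp: in_simps_isoplex_iff in_simps_prism_iff delta_hom_le)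
  have "t \<in> {..M} \<rightarrow>\<^sub>E {0, 1}" and t1: "t (snd b k) = 1 \<Longrightarrow> c (snd b k) < j"
    using g d by (simp_all add: prism_cells_def)
  then have t: "t (snd b k) = 0 \<or> t (snd b k) = 1" using d by auto
  have c: "c (snd b k) = j" if "fst (fst b) k = 1" using s[OF that] c_pivot[OF g] by simp
  show "fst (fst z) k = 1 \<Longrightarrow> snd z k \<le> j"
    "fst (fst b) k = 1 \<longleftrightarrow> fst (fst z) k = 1 \<and> snd z k = j"
    "(if snd z k = j then 0 else fst (fst z) k) = t (snd b k)"
    unfolding z using t t1 c by (cases "fst (fst b) k = 1"; force)+
qed

lemma cell_map_shom:
  assumes g: "g \<in> prism_cells N"
  shows "cell_map g \<in> shom (cell_dom g) (sprod J (Delta N))"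
proof -
  obtain j M t c where g_eq: "g = (j, M, t, c)" by (cases g) auto
  have t: "t \<in> {..M} \<rightarrow>\<^sub>E {0, 1}" and c: "c \<in> delta_hom M N"
    using g by (auto simp: g_eq prism_cells_def)
  have sub: "subcomplex (isoplex (pivot j c) (Suc M)) (sprod J (Delta M))"
    by (rule isoplex_subcomplex)
  show ?thesis
    unfolding g_eq cell_dom_def cell_map_def prod.case
  proof (rule shomI[OF subcomplexD(1)[OF sub]])
    fix m b assume "b \<in> simps (isoplex (pivot j c) (Suc M)) m"
    then have d: "snd b \<in> delta_hom m M" by (simp add: in_simps_isoplex_iff in_simps_prism_iff)
    have "t (snd b k) \<in> {0, 1}" if "k \<le> m" for k
      using t delta_hom_le[OF d that] by auto
    then have "(\<lambda>k\<in>{..m}. if fst (fst b) k = 1 then 1 else t (snd b k)) \<in> {..m} \<rightarrow>\<^sub>E {0, 1}" by auto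
    then show "(Jsimp (\<lambda>k\<in>{..m}. if fst (fst b) k = 1 then 1 else t (snd b k)),
        compose {..m} c (snd b)) \<in> simps (sprod J (Delta N)) m"
      using delta_hom_comp[OF d c] by (simp add: in_simps_prism_iff)
  next
    fix l m \<theta> b assume "\<theta> \<in> delta_hom l m"
    then show "(Jsimp (\<lambda>k\<in>{..l}.
          if fst (fst (act (isoplex (pivot j c) (Suc M)) l m \<theta> b)) k = 1 then 1
          else t (snd (act (isoplex (pivot j c) (Suc M)) l m \<theta> b) k)),
        compose {..l} c (snd (act (isoplex (pivot j c) (Suc M)) l m \<theta> b))) =
      act (sprod J (Delta N)) l m \<theta>
        (Jsimp (\<lambda>k\<in>{..m}. if fst (fst b) k = 1 then 1 else t (snd b k)), compose {..m} c (snd b))"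
      using delta_hom_le[of \<theta> l m]
      by (auto simp: act_isoplex act_prism compose_def fun_eq_iff Jsimp_eq_iff)
  qed
qed

lemma in_cell_interior:
  assumes "(j, M, t, c) \<in> prism_cells N"
    and "b \<in> simps (cell_dom (j, M, t, c)) m - simps (cell_horn (j, M, t, c)) m"
  shows "b \<in> simps (isoplex (pivot j c) (Suc M)) m" "snd b \<in> delta_hom m M" "snd b ` {..m} = {..M}"
    and "\<exists>k\<le>m. fst (fst b) k = 1"
proof -
  show b: "b \<in> simps (isoplex (pivot j c) (Suc M)) m"
    using assms(2) by (simp add: cell_dom_def)
  have "b \<notin> simps (iso_horn (pivot j c) (Suc M)) m"
    using assms(2) by (simp add: cell_horn_def)
  then have surj: "snd b ` {..m} = {..M}" and "\<exists>k\<le>m. fst (fst b) k \<noteq> 0"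
    using b unfolding in_simps_iso_horn_iff by auto
  then obtain k where k: "k \<le> m" "fst (fst b) k \<noteq> 0" by blast
  have s: "fst (fst b) \<in> {..m} \<rightarrow>\<^sub>E {0, 1}" and d: "snd b \<in> delta_hom m M"
    using b unfolding in_simps_isoplex_iff in_simps_prism_iff by auto
  show "snd b ` {..m} = {..M}" "snd b \<in> delta_hom m M" by (fact surj d)+
  have "fst (fst b) k \<in> {0, 1}" using k(1) by (intro PiE_mem[OF s]) simp
  then show "\<exists>k\<le>m. fst (fst b) k = 1" using k by auto
qed

text \<open>An interior simplex surjects onto \<open>{..M}\<close>, which \<open>c\<close> maps onto
  \<open>{..N}\<close>, and its extra vertex supplies a label 1.\<close>

lemma cell_map_avoids:
  assumes g: "g \<in> prism_cells N" and b: "b \<in> simps (cell_dom g) m - simps (cell_horn g) m"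
  shows "cell_map g m b \<notin> simps (J_pushout_product N) m"
proof -
  obtain j M t c where g_eq: "g = (j, M, t, c)" by (cases g) auto
  note g' = g[unfolded g_eq]
  note b' = in_cell_interior[OF g' b[unfolded g_eq]]
  have "snd (cell_map g m b) ` {..m} = c ` snd b ` {..m}"
    unfolding image_image using cell_map_simps(1)[OF g' b'(1)] by (intro image_cong) (simp_all add: g_eq)
  also have "\<dots> = {..N}" using g' b'(3) by (simp add: prism_cells_def)
  finally have "snd (cell_map g m b) ` {..m} = {..N}" .
  moreover obtain k where k: "k \<le> m" "fst (fst b) k = 1" using b'(4) by blast
  moreover have "fst (fst (cell_map g m b)) k = 1"
    using cell_map_simps(4)[OF g' b'(1) k(1)] k(2) by (simp add: g_eq)
  ultimately show ?thesis
    unfolding in_simps_pushout_product_iff by auto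
qed

lemma cell_map_inj:
  assumes g: "g \<in> prism_cells N" and b: "b \<in> simps (cell_dom g) m - simps (cell_horn g) m"
    and g': "g' \<in> prism_cells N" and b': "b' \<in> simps (cell_dom g') m - simps (cell_horn g') m"
    and eq: "cell_map g m b = cell_map g' m b'"
  shows "g = g' \<and> b = b'"
proof -
  obtain j M t c where g_eq: "g = (j, M, t, c)" by (cases g) auto
  obtain j' M' t' c' where g'_eq: "g' = (j', M', t', c')" by (cases g') auto
  note cell = g[unfolded g_eq] and cell' = g'[unfolded g'_eq]
  note B = in_cell_interior[OF cell b[unfolded g_eq]]
    and B' = in_cell_interior[OF cell' b'[unfolded g'_eq]]
  note z = cell_map_simps[OF cell B(1), folded g_eq]
    and z' = cell_map_simps[OF cell' B'(1), folded g'_eq, folded eq]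
  \<comment> \<open>In the common image, each of them is the largest second coordinate of a vertex
    labelled 1.\<close>
  have j: "j = j'"
  proof (rule antisym)
    obtain k where k: "k \<le> m" "fst (fst b) k = 1" using B(4) by blast
    show "j \<le> j'" using z(4)[OF k(1)] z'(3)[OF k(1)] k(2) by simp
    obtain k' where k': "k' \<le> m" "fst (fst b') k' = 1" using B'(4) by blast
    show "j' \<le> j" using z'(4)[OF k'(1)] z(3)[OF k'(1)] k'(2) by simp
  qed
  \<comment> \<open>Lowering \<open>(1, j)\<close> to \<open>(0, j)\<close> in the image gives both
    sequences; Eilenberg-Zilber uniqueness then applies.\<close>
  have td: "(t (snd b k), c (snd b k)) = (t' (snd b' k), c' (snd b' k))" if "k \<le> m" for k
    using z(1)[OF that] z(5)[OF that] z'(1)[OF that] z'(5)[OF that] unfolding j by (metis (no_types))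
  have ne: "(t q, c q) \<noteq> (t (Suc q), c (Suc q))" if "q < M" for q
    using cell that by (simp add: prism_cells_def)
  have ne': "(t' q, c' q) \<noteq> (t' (Suc q), c' (Suc q))" if "q < M'" for q
    using cell' that by (simp add: prism_cells_def)
  note unique = degeneracy_unique[where \<tau> = "\<lambda>q. (t q, c q)" and \<tau>' = "\<lambda>q. (t' q, c' q)",
    OF B(2,3) ne B'(2,3) ne' td]
  have M: "M = M'" and d: "snd b = snd b'" by (rule unique; assumption)+
  note tc = unique(3)
  have "t = t'"
  proof
    fix q show "t q = t' q" using tc[of q] cell cell' M
      by (cases "q \<le> M") (auto simp: prism_cells_def PiE_iff extensional_def)
  qed
  moreover have "c = c'"
  proof
    fix q show "c q = c' q" using tc[of q] cell cell' M
      by (cases "q \<le> M") (auto simp: prism_cells_def delta_hom_def PiE_iff extensional_def)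
  qed
  \<comment> \<open>The labels of \<open>b\<close> and \<open>b'\<close> mark the occurrences of
    \<open>(1, j)\<close> in the common image.\<close>
  moreover have "fst b = fst b'"
  proof (intro J_simplex_eqI ext)
    fix k
    have s: "fst (fst b) \<in> {..m} \<rightarrow>\<^sub>E {0, 1}" "fst (fst b') \<in> {..m} \<rightarrow>\<^sub>E {0, 1}"
      using B(1) B'(1) by (auto simp: in_simps_isoplex_iff in_simps_prism_iff)
    show "fst (fst b) k = fst (fst b') k"
    proof (cases "k \<le> m")
      case True
      then have "fst (fst b) k \<in> {0, 1}" "fst (fst b') k \<in> {0, 1}" using s by auto
      moreover have "fst (fst b) k = 1 \<longleftrightarrow> fst (fst b') k = 1" using z(4)[OF True] z'(4)[OF True] j by simp
      ultimately show ?thesis by auto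
    next
      case False
      then show ?thesis using s by (auto simp: PiE_iff extensional_def)
    qed
  qed
  ultimately show ?thesis
    using j M d by (simp add: g_eq g'_eq prod_eq_iff)
qed

text \<open>A horn simplex either avoids the extra vertex, and then \<open>j\<close> drops while the
  dimension does not grow, or it contains that vertex but misses a vertex of \<Delta>[M], and then
  \<open>j\<close> stays while the dimension drops. Either way the sum decreases.\<close>

lemma cell_map_attaches:
  assumes g: "g \<in> prism_cells N" and b: "b \<in> simps (cell_horn g) m"
    and g': "g' \<in> prism_cells N" and b': "b' \<in> simps (cell_dom g') m - simps (cell_horn g') m"
    and eq: "cell_map g m b = cell_map g' m b'"
  shows "fst g' + fst (snd g') < fst g + fst (snd g)"
proof -
  obtain j M t c where g_eq: "g = (j, M, t, c)" by (cases g) auto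
  obtain j' M' t' c' where g'_eq: "g' = (j', M', t', c')" by (cases g') auto
  note cell = g[unfolded g_eq] and cell' = g'[unfolded g'_eq]
  have B: "b \<in> simps (isoplex (pivot j c) (Suc M)) m"
    and horn: "(\<forall>k\<le>m. fst (fst b) k = 0) \<or> snd b ` {..m} \<noteq> {..M}"
    using b by (auto simp: g_eq cell_horn_def in_simps_iso_horn_iff)
  then have d: "snd b \<in> delta_hom m M" by (simp add: in_simps_isoplex_iff in_simps_prism_iff)
  note B' = in_cell_interior[OF cell' b'[unfolded g'_eq]]
  note z = cell_map_simps[OF cell B, folded g_eq]
    and z' = cell_map_simps[OF cell' B'(1), folded g'_eq, folded eq]
  obtain k' where k': "k' \<le> m" "fst (fst (cell_map g m b)) k' = 1" "snd (cell_map g m b) k' = j'"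
    using B'(4) z'(4) by blast
  have ne: "q < M' \<Longrightarrow> (t' q, c' q) \<noteq> (t' (Suc q), c' (Suc q))" for q
    using cell' by (auto simp: prism_cells_def)
  note card = degeneracy_card[OF d B'(2,3), of "\<lambda>q. (t' q, c' q)", OF ne]
  have image: "snd b ` {..m} \<subseteq> {..M}" using delta_hom_le[OF d] by auto
  show ?thesis
  proof (cases "\<forall>k\<le>m. fst (fst b) k = 0")
    case True
    have "j' \<noteq> j" using z(4)[OF k'(1)] k' True by auto
    then have "j' < j" using z(3)[OF k'(1)] k' by simp
    moreover have "M' < card (snd b ` {..m})"
    \<comment> \<open>Without the extra vertex the image is \<open>(t, c)\<close> along
      \<open>snd b\<close>. Lowering \<open>(1, j')\<close> to \<open>(0, j')\<close> yields the
      sequence of \<open>g'\<close>, which therefore factors through \<open>snd b\<close>.\<close>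
    proof (rule card[where \<psi> = "\<lambda>q. (if c q = j' then 0 else t q, c q)"])
      fix k assume k: "k \<le> m"
      then show "(t' (snd b' k), c' (snd b' k)) =
          (if c (snd b k) = j' then 0 else t (snd b k), c (snd b k))"
        using z(1,2)[OF k] z'(1,5)[OF k] True by auto
    qed
    moreover have "card (snd b ` {..m}) \<le> Suc M" using card_mono[OF _ image] by simp
    ultimately show ?thesis by (simp add: g_eq g'_eq)
  next
    case False
    then obtain k where k: "k \<le> m" "fst (fst b) k \<noteq> 0" by blast
    moreover have "fst (fst b) \<in> {..m} \<rightarrow>\<^sub>E {0, 1}"
      using B by (simp add: in_simps_isoplex_iff in_simps_prism_iff)
    then have "fst (fst b) k \<in> {0, 1}" by (rule PiE_mem) (simp add: k(1))
    ultimately have "fst (fst b) k = 1" by simp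
    then have "j \<le> j'" using z(4)[OF k(1)] z'(3)[OF k(1)] by simp
    moreover have "j' \<le> j" using z(3)[OF k'(1,2)] k'(3) by simp
    ultimately have j: "j = j'" by simp
    have "M' < card (snd b ` {..m})"
    \<comment> \<open>With equal \<open>j\<close>, both cells arise by lowering the same vertex, so
      their sequences coincide.\<close>
    proof (rule card[where \<psi> = "\<lambda>q. (t q, c q)"])
      fix k assume k: "k \<le> m"
      then show "(t' (snd b' k), c' (snd b' k)) = (t (snd b k), c (snd b k))"
        using z(1,5)[OF k] z'(1,5)[OF k] j by auto
    qed
    moreover have "snd b ` {..m} \<subset> {..M}" using horn False image by blast
    then have "card (snd b ` {..m}) < Suc M" using psubset_card_mono[of "{..M}"] by simp
    ultimately show ?thesis using j by (simp add: g_eq g'_eq)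
  qed
qed

text \<open>Lower the highest vertex labelled 1 wherever it occurs in \<open>z\<close>, collapse the
  repetitions to obtain the cell, and let \<open>b\<close> remember the degeneracy and the lowered
  positions.\<close>

lemma cell_map_cover:
  assumes z: "z \<in> simps (sprod J (Delta N)) m" "z \<notin> simps (J_pushout_product N) m"
  shows "\<exists>g\<in>prism_cells N. \<exists>b\<in>simps (cell_dom g) m - simps (cell_horn g) m. cell_map g m b = z"
proof -
  define F where "F = fst (fst z)"
  define e where "e = snd z"
  have F: "F \<in> {..m} \<rightarrow>\<^sub>E {0, 1}" and e: "e \<in> delta_hom m N" and surj: "e ` {..m} = {..N}"
    and nz: "\<exists>k\<le>m. F k \<noteq> 0"
    using z unfolding in_simps_pushout_product_iff in_simps_prism_iff F_def e_def by blast+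
  have F01: "F k \<in> {0, 1}" if "k \<le> m" for k using that by (intro PiE_mem[OF F]) simp
  obtain k1 where k1: "k1 \<le> m" "F k1 \<noteq> 0" using nz by blast
  then have ex: "F k1 = 1" using F01[OF k1(1)] by simp
  \<comment> \<open>The first stage of the successive widening at which \<open>z\<close> is
    present.\<close>
  define j where "j = Max {e k | k. k \<le> m \<and> F k = 1}"
  have fin: "finite {e k | k. k \<le> m \<and> F k = 1}" by simp
  have "j \<in> {e k | k. k \<le> m \<and> F k = 1}" unfolding j_def using k1(1) ex by (intro Max_in[OF fin]) blast
  then obtain k0 where k0: "k0 \<le> m" "F k0 = 1" "e k0 = j" by blast
  have le_j: "e k \<le> j" if "k \<le> m" "F k = 1" for k
    unfolding j_def using that by (intro Max_ge[OF fin]) blast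
  define F' where "F' k = (if e k = j then 0 else F k)" for k
  obtain d \<tau> where d: "d 0 = 0" "\<And>k. k < m \<Longrightarrow> d (Suc k) = d k \<or> d (Suc k) = Suc (d k)"
    "\<And>k. k \<le> m \<Longrightarrow> d k \<le> d m \<and> \<tau> (d k) = (F' k, e k)" "\<And>q. q < d m \<Longrightarrow> \<tau> q \<noteq> \<tau> (Suc q)"
    using degeneracy_exists[of m "\<lambda>k. (F' k, e k)"] by blast
  define M where "M = d m"
  define t where "t = (\<lambda>q\<in>{..M}. fst (\<tau> q))"
  define c where "c = (\<lambda>q\<in>{..M}. snd (\<tau> q))"
  have dm: "d ` {..m} = {..M}" unfolding M_def using d(1,2) by (rule unit_steps_image)
  have tc: "t (d k) = F' k" "c (d k) = e k" if "k \<le> m" for k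
    using d(3)[OF that] by (auto simp: t_def c_def M_def)
  have lift: "\<exists>k\<le>m. d k = q" if "q \<le> M" for q using dm that by (metis atMost_iff imageE)
  have d_less: "d l \<le> d k" if "l \<le> k" "k \<le> m" for k l
    using that
  proof (induction k rule: dec_induct)
    case (step k)
    then show ?case using d(2)[of k] by auto
  qed simp
  have cell: "(j, M, t, c) \<in> prism_cells N"
  proof -
    have "j \<le> N" using delta_hom_le[OF e k0(1)] k0(3) by simp
    moreover have "t q \<in> {0, 1}" if q: "q \<le> M" for q
    proof -
      obtain k where k: "k \<le> m" "d k = q" using lift[OF q] by blast
      have "t q = F' k" using tc(1)[OF k(1)] k(2) by simp
      then show ?thesis using F01[OF k(1)] by (simp add: F'_def)
    qed
    then have "t \<in> {..M} \<rightarrow>\<^sub>E {0, 1}" by (auto simp: t_def)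
    moreover have "c \<in> delta_hom M N"
    proof -
      have "c q \<le> N" if q: "q \<le> M" for q
      proof -
        obtain k where k: "k \<le> m" "d k = q" using lift[OF q] by blast
        then show ?thesis using tc(2)[OF k(1)] delta_hom_le[OF e k(1)] by simp
      qed
      moreover have "c p \<le> c q" if pq: "p \<le> q" "q \<le> M" for p q
      proof -
        obtain k l where kl: "k \<le> m" "d k = p" "l \<le> m" "d l = q"
          using lift[of p] lift[of q] pq by (metis le_trans)
        \<comment> \<open>If \<open>k\<close> exceeds \<open>l\<close>, monotonicity of
          \<open>d\<close> squeezes \<open>p\<close> and \<open>q\<close> together.\<close>
        have "e k \<le> e l"
        proof (cases "k \<le> l")
          case True
          then show ?thesis using delta_hom_mono[OF e] kl by simp
        next
          case False
          then have "p = q" using d_less[of l k] kl pq by simp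
          then show ?thesis using tc(2)[OF kl(1)] tc(2)[OF kl(3)] kl by simp
        qed
        then show ?thesis using tc(2)[OF kl(1)] tc(2)[OF kl(3)] kl by simp
      qed
      ultimately show ?thesis by (auto simp: delta_hom_def mono_on_def c_def)
    qed
    moreover have "c ` {..M} = e ` {..m}" unfolding dm[symmetric] image_image using tc(2) by simp
    then have "c ` {..M} = {..N}" using surj by simp
    \<comment> \<open>A label 1 that survives the lowering does not lie over \<open>j\<close>, hence
      lies below it by maximality.\<close>
    moreover have "c q < j" if q: "q \<le> M" "t q = 1" for q
    proof -
      obtain k where k: "k \<le> m" "d k = q" using lift[OF q(1)] by blast
      then have "F' k = 1" using tc(1)[OF k(1)] q by simp
      then have "e k \<noteq> j" "F k = 1" by (simp_all add: F'_def split: if_splits)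
      then have "e k < j" using le_j[OF k(1)] by simp
      then show ?thesis using tc(2)[OF k(1)] k(2) by simp
    qed
    moreover have "(t q, c q) \<noteq> (t (Suc q), c (Suc q))" if "q < M" for q
      using d(4)[of q] that by (simp add: t_def c_def M_def prod_eq_iff)
    ultimately show ?thesis by (simp add: prism_cells_def)
  qed
  define b where "b = (Jsimp (\<lambda>k\<in>{..m}. if F k = 1 \<and> e k = j then 1 else 0), \<lambda>k\<in>{..m}. d k)"
  have dM: "d k \<le> M" if "k \<le> m" for k using d(3)[OF that] by (simp add: M_def)
  \<comment> \<open>All occurrences of \<open>j\<close> in \<open>e\<close> collapse to the single
    position of \<open>j\<close> in the cell, so label 1 in \<open>b\<close> sits over the pivot
    only, as the isoplex demands.\<close>
  have "d k = pivot j c" if "k \<le> m" "e k = j" for k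
    using that tc(2)[OF that(1)] dM[OF that(1)] by (intro pivot_unique[OF cell]) simp_all
  moreover have "(\<lambda>k\<in>{..m}. d k) \<in> delta_hom m M"
    using dM d_less by (simp add: delta_hom_def mono_on_def)
  ultimately have b: "b \<in> simps (isoplex (pivot j c) (Suc M)) m"
    unfolding in_simps_isoplex_iff in_simps_prism_iff by (simp add: b_def)
  moreover have "b \<notin> simps (iso_horn (pivot j c) (Suc M)) m"
    unfolding in_simps_iso_horn_iff using k0 dm by (auto simp: b_def)
  moreover have "cell_map (j, M, t, c) m b = z"
  proof -
    have "(\<lambda>k\<in>{..m}. if F k = 1 \<and> e k = j then 1 else t (d k)) = F"
    proof
      fix k show "(\<lambda>k\<in>{..m}. if F k = 1 \<and> e k = j then 1 else t (d k)) k = F k"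
        using tc(1)[of k] F by (cases "k \<le> m") (auto simp: F'_def PiE_iff extensional_def)
    qed
    moreover have "(\<lambda>k\<in>{..m}. if fst (fst b) k = 1 then 1 else t (snd b k)) =
        (\<lambda>k\<in>{..m}. if F k = 1 \<and> e k = j then 1 else t (d k))"
      by (auto simp: b_def)
    moreover have "compose {..m} c (snd b) = e"
    proof
      fix k show "compose {..m} c (snd b) k = e k"
        using tc(2)[of k] e
        by (cases "k \<le> m") (auto simp: b_def compose_def delta_hom_def PiE_iff extensional_def)
    qed
    moreover have "Jsimp F = fst z" by (rule J_simplex_eqI) (simp add: F_def)
    ultimately show ?thesis
      using b by (simp add: cell_map_def e_def)
  qed
  ultimately show ?thesis
    using cell by (intro bexI[of _ "(j, M, t, c)"] bexI[of _ b]) (auto simp: cell_dom_def cell_horn_def)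
qed

section \<open>Filling the prism cell by cell, and the equivalence\<close>

lemma has_lifts_pushout_product_if_iso_horns:
  assumes X: "simplicial_set X"
    and lifts: "\<And>M i. i \<le> M \<Longrightarrow> has_lifts X (iso_horn i (Suc M)) (isoplex i (Suc M))"
  shows "has_lifts X (J_pushout_product N) (sprod J (Delta N))"
proof (rule has_lifts_cell_complex[OF X J_pushout_product_subcomplex,
      where G = "prism_cells N" and B = cell_dom and C = cell_horn and \<phi> = cell_map
        and rank = "\<lambda>g. fst g + fst (snd g)"])
  fix g assume g: "g \<in> prism_cells N"
  obtain j M t c where g_eq: "g = (j, M, t, c)" by (cases g) auto
  show "subcomplex (cell_horn g) (cell_dom g)"
    by (simp add: g_eq cell_horn_def cell_dom_def iso_horn_subcomplex)
  show "has_lifts X (cell_horn g) (cell_dom g)"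
    using lifts[OF pivot_le[OF g[unfolded g_eq]]] by (simp add: g_eq cell_horn_def cell_dom_def)
  show "cell_map g \<in> shom (cell_dom g) (sprod J (Delta N))" using g by (rule cell_map_shom)
qed (use cell_map_cover cell_map_avoids cell_map_inj cell_map_attaches in blast)+

theorem mainTheorem1:
  fixes M :: "'a model_data" and X :: "'a sset"
  assumes "minimal_model_structure M" and "simplicial_set X"
  shows "fibrant M X \<longleftrightarrow>
    (\<forall>n\<ge>1. \<forall>i\<le>n - 1. has_lifts X (iso_horn i n) (isoplex i n))"
proof -
  have "fibrant M X \<longleftrightarrow> (\<forall>N. has_lifts X (J_pushout_product N) (sprod J (Delta N)))"
    using assms unfolding minimal_model_structure_def by blast
  also have "\<dots> \<longleftrightarrow> (\<forall>N. \<forall>i\<le>N. has_lifts X (iso_horn i (Suc N)) (isoplex i (Suc N)))"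
    using has_lifts_iso_horn_if_pushout_product has_lifts_pushout_product_if_iso_horns assms(2)
    by blast
  \<comment> \<open>Reindexing by \<open>n = Suc N\<close>: the isoplex of index \<open>n\<close> is
    built on \<Delta>[n - 1], and \<open>n \<ge> 1\<close> makes the subtraction exact.\<close>
  also have "\<dots> \<longleftrightarrow> (\<forall>n\<ge>1. \<forall>i\<le>n - 1. has_lifts X (iso_horn i n) (isoplex i n))"
    by (metis One_nat_def Suc_le_D diff_Suc_1 le_add1 plus_1_eq_Suc)
  finally show ?thesis .
qed

end
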